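(* Let $1\le p\le\infty$, $s\ge 0$, $u\in\mathcal{S}'(\mathbb{R}^n)$, $\varphi\in\mathcal{S}(\mathbb{R}^n)\setminus\{0\}$ and $z_0\in\mathbb{R}^{2n}\setminus\{0\}$. Assume that there exists an open conic neighbourhood $\Gamma_{z_0}$ of $z_0$ in $\mathbb{R}^{2n}\setminus\{0\}$ such that $$\int_{\Gamma_{z_0}} |V_\varphi u(z)|^p\,\langle z\rangle^{sp}\,dz<\infty$$ (if $p=\infty$, this condition is replaced by $\operatorname{ess\,sup}_{z\in\Gamma_{z_0}}|V_\varphi u(z)|\langle z\rangle^{s}<\infty$). Then for any open conic neighbourhood $\Gamma_{z_0}'$ of $z_0$ in $\mathbb{R}^{2n}\setminus\{0\}$ such that $\overline{\Gamma_{z_0}'\cap\mathbb{S}^{2n-1}}\subseteq\Gamma_{z_0}$ and any $\psi\in\mathcal{S}(\mathbb{R}^n)\setminus\{0\}$ we have $$\int_{\Gamma_{z_0}'} |V_\psi u(z)|^p\,\langle z\rangle^{sp}\,dz<\infty$$ (if $p=\infty$, this is replaced by $\operatorname{ess\,sup}_{z\in\Gamma_{z_0}'}|V_\psi u(z)|\langle z\rangle^{s}<\infty$).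
   Context: $\mathcal{S}(\mathbb{R}^n)$ is the Schwartz class and $\mathcal{S}'(\mathbb{R}^n)$ the space of temperate distributions. The brackets $\langle f,g\rangle$ denote the extension to $\mathcal{S}'(\mathbb{R}^n)\times\mathcal{S}(\mathbb{R}^n)$ of the inner product $\langle f,g\rangle=\int_{\mathbb{R}^n}f(x)\overline{g(x)}\,dx$ on $L^2(\mathbb{R}^n)$ (linear in the first entry, conjugate-linear in the second). For $z\in\mathbb{R}^{2n}$, $\langle z\rangle=(1+|z|^2)^{1/2}$. For $x,\xi\in\mathbb{R}^n$ set $(T_xf)(y)=f(y-x)$, $(M_\xi f)(y)=e^{2\pi i\xi\cdot y}f(y)$ and $\pi(x,\xi)=M_\xi T_x$. The short-time Fourier transform of $u\in\mathcal{S}'(\mathbb{R}^n)$ with window $\varphi\in\mathcal{S}(\mathbb{R}^n)\setminus\{0\}$ is the continuous function on $\mathbb{R}^{2n}$ given by $$V_\varphi u(x,\xi)=\langle u,\pi(x,\xi)\varphi\rangle=\int_{\mathbb{R}^n}e^{-2\pi i y\cdot\xi}\,u(y)\,\overline{\varphi(y-x)}\,dy,\qquad (x,\xi)\in\mathbb{R}^{2n},$$ where the integral is understood formally (as a duality pairing). A set $\Gamma\subset\mathbb{R}^{2n}\setminus\{0\}$ is conic if $z\in\Gamma$ implies $\lambda z\in\Gamma$ for all $\lambda>0$; an open conic neighbourhood of $z_0$ is an open conic set containing $z_0$. $\mathbb{S}^{2n-1}$ is the unit sphere of $\mathbb{R}^{2n}$. *)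

theory Defs
  imports "HOL-Analysis.Analysis" "HOL-Probability.Essential_Supremum"
begin

definition japanese_bracket :: "'a::real_normed_vector \<Rightarrow> real" where
  "japanese_bracket z = sqrt (1 + (norm z)\<^sup>2)"


section \<open>The Schwartz class\<close>

text \<open>For differentiable \<open>f\<close> the Frechet derivative applied to the \<open>i\<close>-th unit vector is the
  \<open>i\<close>-th partial derivative; it is only used in that situation. Multi-indices are represented by
  lists of coordinate directions, so that no order on the index type is needed.\<close>

definition partial_deriv :: "'n \<Rightarrow> (real^'n \<Rightarrow> complex) \<Rightarrow> (real^'n \<Rightarrow> complex)" where
  "partial_deriv i f = (\<lambda>x. frechet_derivative f (at x) (axis i 1))"

definition iter_partial :: "'n list \<Rightarrow> (real^'n \<Rightarrow> complex) \<Rightarrow> (real^'n \<Rightarrow> complex)" where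
  "iter_partial is f = foldr partial_deriv is f"

definition smooth :: "(real^'n \<Rightarrow> complex) \<Rightarrow> bool" where
  "smooth f \<longleftrightarrow> (\<forall>is x. iter_partial is f differentiable (at x))"

definition schwartz :: "(real^'n \<Rightarrow> complex) set" where
  "schwartz = {f. smooth f \<and>
     (\<forall>k is. bdd_above (range (\<lambda>x. japanese_bracket x ^ k * norm (iter_partial is f x))))}"

definition schwartz_seminorm :: "nat \<Rightarrow> 'n list \<Rightarrow> (real^'n \<Rightarrow> complex) \<Rightarrow> real" where
  "schwartz_seminorm k is f = (SUP x. japanese_bracket x ^ k * norm (iter_partial is f x))"

text \<open>Basic neighbourhoods of \<open>f\<close> for the locally convex topology of the Schwartz class: all
  seminorms up to order \<open>N\<close> are used at once, and these are finitely many.\<close>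

definition schwartz_ball :: "(real^'n \<Rightarrow> complex) \<Rightarrow> nat \<Rightarrow> real \<Rightarrow> (real^'n \<Rightarrow> complex) set" where
  "schwartz_ball f N e =
     {g \<in> schwartz. \<forall>k is. k \<le> N \<longrightarrow> length is \<le> N \<longrightarrow>
        schwartz_seminorm k is (\<lambda>x. g x - f x) < e}"

definition schwartz_topology :: "(real^'n \<Rightarrow> complex) topology" where
  "schwartz_topology = topology (\<lambda>U. U \<subseteq> schwartz \<and>
     (\<forall>f\<in>U. \<exists>N e. 0 < e \<and> schwartz_ball f N e \<subseteq> U))"

lemma schwartz_ball_subset: "schwartz_ball f N e \<subseteq> schwartz"
  by (auto simp: schwartz_ball_def)

lemma schwartz_ball_mono:
  assumes "N \<le> N'" "e' \<le> e"
  shows "schwartz_ball f N' e' \<subseteq> schwartz_ball f N e"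
proof
  fix g assume g: "g \<in> schwartz_ball f N' e'"
  have "schwartz_seminorm k is (\<lambda>x. g x - f x) < e" if "k \<le> N" "length is \<le> N" for k "is"
  proof -
    have "k \<le> N'" "length is \<le> N'" using that assms(1) by linarith+
    then have "schwartz_seminorm k is (\<lambda>x. g x - f x) < e'"
      using g by (simp add: schwartz_ball_def)
    then show ?thesis using assms(2) by linarith
  qed
  then show "g \<in> schwartz_ball f N e" using g by (simp add: schwartz_ball_def)
qed

lemma openin_schwartz_topology:
  fixes U :: "(real^'n \<Rightarrow> complex) set"
  shows "openin schwartz_topology U \<longleftrightarrow>
     U \<subseteq> schwartz \<and> (\<forall>f\<in>U. \<exists>N e. 0 < e \<and> schwartz_ball f N e \<subseteq> U)"
proof -
  let ?P = "\<lambda>U::(real^'n \<Rightarrow> complex) set. U \<subseteq> schwartz \<and>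
     (\<forall>f\<in>U. \<exists>N e. 0 < e \<and> schwartz_ball f N e \<subseteq> U)"
  have inter: "?P (S \<inter> T)" if S: "?P S" and T: "?P T" for S T
  proof (intro conjI ballI)
    show "S \<inter> T \<subseteq> schwartz" using S by blast
    fix f assume "f \<in> S \<inter> T"
    then have "f \<in> S" "f \<in> T" by simp_all
    from S \<open>f \<in> S\<close> obtain N e where 1: "0 < e" "schwartz_ball f N e \<subseteq> S" by blast
    from T \<open>f \<in> T\<close> obtain N' e' where 2: "0 < e'" "schwartz_ball f N' e' \<subseteq> T" by blast
    have "schwartz_ball f (max N N') (min e e') \<subseteq> schwartz_ball f N e"
         "schwartz_ball f (max N N') (min e e') \<subseteq> schwartz_ball f N' e'"
      by (rule schwartz_ball_mono; simp)+
    then have "schwartz_ball f (max N N') (min e e') \<subseteq> S \<inter> T"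
      using 1(2) 2(2) by (simp add: subset_trans)
    moreover have "0 < min e e'" using 1 2 by simp
    ultimately show "\<exists>N e. 0 < e \<and> schwartz_ball f N e \<subseteq> S \<inter> T"
      by (intro exI conjI)
  qed
  have union: "?P (\<Union>K)" if K: "\<And>S. S \<in> K \<Longrightarrow> ?P S" for K
  proof (intro conjI ballI)
    show "\<Union>K \<subseteq> schwartz" using K by (intro Sup_least) simp
    fix f assume "f \<in> \<Union>K"
    then obtain S where "S \<in> K" "f \<in> S" by blast
    then obtain N e where "0 < e" "schwartz_ball f N e \<subseteq> S" using K[of S] by blast
    then have "0 < e" "schwartz_ball f N e \<subseteq> \<Union>K" using \<open>S \<in> K\<close> by blast+
    then show "\<exists>N e. 0 < e \<and> schwartz_ball f N e \<subseteq> \<Union>K"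
      by (intro exI conjI)
  qed
  have "istopology ?P"
    unfolding istopology_def by (intro conjI allI impI inter union) simp_all
  then show ?thesis
    unfolding schwartz_topology_def by (simp add: topology_inverse')
qed

lemma topspace_schwartz_topology: "topspace schwartz_topology = schwartz"
proof (rule antisym)
  show "topspace schwartz_topology \<subseteq> schwartz"
    by (meson openin_schwartz_topology openin_topspace)
  have "openin schwartz_topology schwartz"
    unfolding openin_schwartz_topology using schwartz_ball_subset zero_less_one by blast
  then show "schwartz \<subseteq> topspace schwartz_topology"
    by (rule openin_subset)
qed


section \<open>Temperate distributions and the short-time Fourier transform\<close>

text \<open>A temperate distribution is a continuous complex-linear functional on the Schwartz class;
  its values outside the Schwartz class are irrelevant.\<close>

definition temperate_distribution :: "((real^'n \<Rightarrow> complex) \<Rightarrow> complex) \<Rightarrow> bool" where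
  "temperate_distribution u \<longleftrightarrow>
     (\<forall>f\<in>schwartz. \<forall>g\<in>schwartz. u (\<lambda>x. f x + g x) = u f + u g) \<and>
     (\<forall>c. \<forall>f\<in>schwartz. u (\<lambda>x. c * f x) = c * u f) \<and>
     continuous_map schwartz_topology euclidean u"

text \<open>The bracket is conjugate-linear in the test function, while distributions act linearly, hence
  the conjugate. A function \<open>f\<close> is identified with the functional \<open>g \<mapsto> \<integral> f g\<close>, and then
  the bracket is the \<open>L\<^sup>2\<close> inner product.\<close>

definition bracket :: "((real^'n \<Rightarrow> complex) \<Rightarrow> complex) \<Rightarrow> (real^'n \<Rightarrow> complex) \<Rightarrow> complex" where
  "bracket u g = u (\<lambda>x. cnj (g x))"

lemma bracket_function:
  "bracket (\<lambda>g. LINT x|lborel. f x * g x) g = (LINT x|lborel. f x * cnj (g x))"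
  by (simp add: bracket_def)

definition translation :: "real^'n \<Rightarrow> (real^'n \<Rightarrow> complex) \<Rightarrow> (real^'n \<Rightarrow> complex)" where
  "translation x f = (\<lambda>y. f (y - x))"

definition modulation :: "real^'n \<Rightarrow> (real^'n \<Rightarrow> complex) \<Rightarrow> (real^'n \<Rightarrow> complex)" where
  "modulation \<xi> f = (\<lambda>y. exp (2 * of_real pi * \<i> * of_real (\<xi> \<bullet> y)) * f y)"

definition tf_shift :: "(real^'n) \<times> (real^'n) \<Rightarrow> (real^'n \<Rightarrow> complex) \<Rightarrow> (real^'n \<Rightarrow> complex)" where
  "tf_shift z f = modulation (snd z) (translation (fst z) f)"

definition stft ::
  "(real^'n \<Rightarrow> complex) \<Rightarrow> ((real^'n \<Rightarrow> complex) \<Rightarrow> complex) \<Rightarrow> (real^'n) \<times> (real^'n) \<Rightarrow> complex" where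
  "stft \<phi> u z = bracket u (tf_shift z \<phi>)"


section \<open>Conic sets and weighted integrability\<close>

text \<open>This differs from the library's \<^const>\<open>conic\<close>, which forces nonempty sets to contain the
  origin.\<close>

definition punctured_conic :: "'a::real_vector set \<Rightarrow> bool" where
  "punctured_conic \<Gamma> \<longleftrightarrow> 0 \<notin> \<Gamma> \<and> (\<forall>z\<in>\<Gamma>. \<forall>r>0. r *\<^sub>R z \<in> \<Gamma>)"

definition open_conic_nhd :: "'a::real_normed_vector \<Rightarrow> 'a set \<Rightarrow> bool" where
  "open_conic_nhd z \<Gamma> \<longleftrightarrow> open \<Gamma> \<and> punctured_conic \<Gamma> \<and> z \<in> \<Gamma>"

definition weighted_Lp_on :: "ennreal \<Rightarrow> real \<Rightarrow> 'a::euclidean_space set \<Rightarrow> ('a \<Rightarrow> complex) \<Rightarrow> bool" where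
  "weighted_Lp_on p s \<Gamma> F \<longleftrightarrow>
     (if p = \<infinity> then
        esssup (restrict_space lborel \<Gamma>)
          (\<lambda>z. ennreal (norm (F z) * japanese_bracket z powr s)) < \<infinity>
      else
        (\<integral>\<^sup>+ z\<in>\<Gamma>. ennreal (norm (F z) powr enn2real p *
            japanese_bracket z powr (s * enn2real p)) \<partial>lborel) < \<infinity>)"

end

theory Submission
  imports Defs "HOL-Probability.Sinc_Integral" "HOL-Probability.Characteristic_Functions"
begin

text \<open>
  The inversion formula \<open>\<psi> = \<parallel>\<phi>\<parallel>\<^sup>-\<^sup>2 \<integral> V\<^sub>\<phi>\<psi>(w) \<pi>(w)\<phi> dw\<close> has a rapidly decreasing coefficient \<open>V\<^sub>\<phi>\<psi>\<close>.
  Replacing \<open>w\<close> by simple functions \<open>r\<^sub>k(w) \<rightarrow> w\<close> yields finite sums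
  \<open>\<Sum>\<^sub>v a\<^sub>k(v) \<pi>(v)\<phi>\<close> that converge to \<open>\<psi>\<close> pointwise while
  \<open>\<Sum>\<^sub>v |a\<^sub>k(v)| \<langle>v\<rangle>\<^sup>L\<close> stays bounded for every \<open>L\<close>. Pointwise convergence of a sequence bounded in
  all Schwartz seminorms is convergence in the Schwartz class, so
  \<open>|V\<^sub>\<psi>u(z)|\<close> is at most the lower limit of \<open>\<Sum>\<^sub>v |a\<^sub>k(v)| |V\<^sub>\<phi>u(z + v)|\<close>; no integral has to be
  exchanged with the distribution \<open>u\<close>. For \<open>z \<in> \<Gamma>'\<close> either \<open>z + v \<in> \<Gamma>\<close>, where the hypothesis applies, or
  \<open>|v| \<ge> \<epsilon> |z|\<close>, where powers of \<open>\<langle>v\<rangle>\<close> absorb both the polynomial growth of \<open>V\<^sub>\<phi>u\<close> and the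
  weight. Jensen's inequality and Fatou's lemma conclude.
\<close>

text \<open>The obstacle is that \<open>u\<close> is only an abstract continuous functional: writing
  V_psi u as an integral of V_phi u would need a Schwartz-valued integral and its exchange with
  \<open>u\<close>. Finite sums need only the linearity of \<open>u\<close>, but their convergence
  must then hold in the Schwartz topology. Compactness supplies this: bounded derivatives give
  equicontinuity, spare decay confines the critical points to a ball, and difference quotients carry
  pointwise convergence over to derivatives. The moments of the coefficients stay bounded because
  |r_k(w)| <= 2|w|: a coefficient is an integral over a level set of r_k, so its contribution to the
  L-th moment is at most 2^L times that of the integrand. All moments occur, since the seminorms of
  pi(v)phi grow like powers of <v> of any degree. For finite p the part outside the cone must
  moreover be integrable in z; further powers of <v> therefore buy a factor <z>^(-4n), the exponent
  \<open>2 * DIM\<close> of phase space.\<close>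

abbreviation jb :: "'a::real_normed_vector \<Rightarrow> real" where
  "jb \<equiv> japanese_bracket"

section \<open>Inequalities for the Japanese bracket\<close>

lemma jb_ge_1 [simp]: "1 \<le> jb z"
  by (simp add: japanese_bracket_def)

lemma jb_pos [simp]: "0 < jb z"
  using jb_ge_1[of z] by linarith

lemma jb_nonneg [simp]: "0 \<le> jb z"
  using jb_ge_1[of z] by linarith

lemma jb_sq: "(jb z)\<^sup>2 = 1 + (norm z)\<^sup>2"
  by (simp add: japanese_bracket_def)

lemma norm_le_jb: "norm z \<le> jb z"
  unfolding japanese_bracket_def by (rule real_le_rsqrt) simp

lemma jb_le_1_norm: "jb z \<le> 1 + norm z"
  unfolding japanese_bracket_def by (rule real_le_lsqrt) (simp_all add: power2_eq_square algebra_simps)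

lemma jb_uminus [simp]: "jb (- z) = jb z"
  by (simp add: japanese_bracket_def)

lemma jb_mono: "norm a \<le> norm b \<Longrightarrow> jb a \<le> jb b"
  unfolding japanese_bracket_def by (simp add: power_mono)

text \<open>The bracket contains an additive 1, which a factor \<open>1 \<le> c\<close> absorbs into
  \<open>c\<^sup>2\<close>.\<close>

lemma jb_scale_le:
  assumes "norm a \<le> c * norm b" "1 \<le> c"
  shows "jb a \<le> c * jb b"
proof -
  have "(jb a)\<^sup>2 \<le> c\<^sup>2 + (c * norm b)\<^sup>2"
    using assms unfolding jb_sq by (intro add_mono power_mono) (auto simp: one_le_power)
  also have "\<dots> = (c * jb b)\<^sup>2"
    by (simp add: power_mult_distrib jb_sq algebra_simps)
  finally show ?thesis
    by (rule power2_le_imp_le) (use assms in simp)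
qed

text \<open>Peetre's inequality: \<open>(norm a + norm b)\<^sup>2\<close> is at most twice the sum
  of the squares, and the product of the squared brackets contains that sum. It moves weights
  between a point and its translate at a polynomial price, for windows as well as for cones.\<close>

lemma jb_peetre: "jb (a + b) \<le> 2 * jb a * jb b"
proof (rule power2_le_imp_le)
  have "(norm (a + b))\<^sup>2 \<le> (norm a + norm b)\<^sup>2"
    by (intro power_mono norm_triangle_ineq) simp
  also have "\<dots> \<le> 2 * (norm a)\<^sup>2 + 2 * (norm b)\<^sup>2"
    using sum_squares_bound[of "norm a" "norm b"] by (simp add: power2_sum)
  finally have *: "(norm (a + b))\<^sup>2 \<le> 2 * (norm a)\<^sup>2 + 2 * (norm b)\<^sup>2" .
  have "0 \<le> (norm a)\<^sup>2 * (norm b)\<^sup>2" by simp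
  then have "1 + (norm (a + b))\<^sup>2 \<le> 4 * ((1 + (norm a)\<^sup>2) * (1 + (norm b)\<^sup>2))"
    using * zero_le_power2[of "norm a"] zero_le_power2[of "norm b"] unfolding distrib_left distrib_right by linarith
  then show "(jb (a + b))\<^sup>2 \<le> (2 * jb a * jb b)\<^sup>2"
    by (simp only: power_mult_distrib jb_sq) (simp add: algebra_simps)
  show "0 \<le> 2 * jb a * jb b" by simp
qed

lemma jb_fst: "jb (fst w) \<le> jb w"
  using norm_fst_le[of "fst w" "snd w"] by (intro jb_mono) simp

lemma jb_snd: "jb (snd w) \<le> jb w"
  using norm_snd_le[of "snd w" "fst w"] by (intro jb_mono) simp

text \<open>The squares differ by the cross term |a|^2 |b|^2. Joint decay in phase space thus
  follows from decay in position times decay in frequency.\<close>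

lemma jb_Pair: "jb (a, b) \<le> jb a * jb b"
  unfolding japanese_bracket_def real_sqrt_mult[symmetric]
  by (rule real_sqrt_le_mono) (auto simp: norm_Pair algebra_simps)

lemma continuous_on_jb [continuous_intros]:
  "continuous_on S f \<Longrightarrow> continuous_on S (\<lambda>x. jb (f x))"
  unfolding japanese_bracket_def by (intro continuous_intros)

lemma borel_measurable_jb [measurable]: "jb \<in> borel_measurable borel"
  by (intro borel_measurable_continuous_onI continuous_intros)

section \<open>Jets of smooth functions\<close>

lemma partial_deriv_eq:
  "(f has_derivative D) (at x) \<Longrightarrow> partial_deriv i f x = D (axis i 1)"
  unfolding partial_deriv_def by (simp add: frechet_derivative_at[symmetric])

lemma has_derivative_frechet:
  "f differentiable (at x) \<Longrightarrow> (f has_derivative frechet_derivative f (at x)) (at x)"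
  by (simp add: frechet_derivative_works[symmetric])

text \<open>A finite-order form of \<open>smooth\<close> made for induction. The second clause keeps
  \<open>diff_order N f\<close> because the Leibniz rule puts \<open>f\<close> itself next to
  derivatives of \<open>g\<close>, and both factors must be differentiable to the same
  order.\<close>

fun diff_order :: "nat \<Rightarrow> (real^'n \<Rightarrow> complex) \<Rightarrow> bool" where
  "diff_order 0 f \<longleftrightarrow> (\<forall>x. f differentiable (at x))"
| "diff_order (Suc N) f \<longleftrightarrow> diff_order N f \<and> (\<forall>i. diff_order N (partial_deriv i f))"

lemma diff_order_differentiable: "diff_order N f \<Longrightarrow> f differentiable (at x)"
  by (induction N) auto

lemma smooth_differentiable: "smooth f \<Longrightarrow> f differentiable (at x)"
  unfolding smooth_def iter_partial_def by (metis foldr_Nil id_apply)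

lemma iter_partial_snoc: "iter_partial (is @ [i]) f = iter_partial is (partial_deriv i f)"
  by (simp add: iter_partial_def)

lemma smooth_partial_deriv: "smooth f \<Longrightarrow> smooth (partial_deriv i f)"
  unfolding smooth_def iter_partial_snoc[symmetric] by blast

text \<open>\<open>iter_partial\<close> folds from the right, so the last entry of the list is the
  innermost derivative, the one that \<open>diff_order\<close> peels off. Lists are therefore
  consumed from their end.\<close>

lemma smooth_iff_diff_order: "smooth f \<longleftrightarrow> (\<forall>N. diff_order N f)"
proof
  show "\<forall>N. diff_order N f" if "smooth f"
  proof
    fix N show "diff_order N f" using that
      by (induction N arbitrary: f) (auto intro: smooth_differentiable smooth_partial_deriv)
  qed
next
  have "iter_partial is g differentiable (at x)" if "diff_order (length is) g" for "is" x and g :: "real^'n \<Rightarrow> complex"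
    using that
  proof (induction "is" arbitrary: g rule: rev_induct)
    case Nil
    then show ?case by (simp add: iter_partial_def)
  next
    case (snoc i "is")
    then show ?case by (simp add: iter_partial_snoc)
  qed
  then show "smooth f" if "\<forall>N. diff_order N f"
    using that unfolding smooth_def by blast
qed

lemma smoothI: "(\<And>N. diff_order N f) \<Longrightarrow> smooth f"
  by (simp add: smooth_iff_diff_order)

lemma smoothD: "smooth f \<Longrightarrow> diff_order N f"
  by (simp add: smooth_iff_diff_order)

lemma partial_deriv_const: "partial_deriv i (\<lambda>x. c) = (\<lambda>x. 0)"
  by (auto simp: partial_deriv_def)

lemma partial_deriv_add:
  assumes "f differentiable (at x)" "g differentiable (at x)"
  shows "partial_deriv i (\<lambda>y. f y + g y) x = partial_deriv i f x + partial_deriv i g x"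
  by (subst partial_deriv_eq[OF has_derivative_add[OF assms[THEN has_derivative_frechet]]])
     (simp add: partial_deriv_def)

lemma partial_deriv_mult:
  assumes "f differentiable (at x)" "g differentiable (at x)"
  shows "partial_deriv i (\<lambda>y. f y * g y) x = f x * partial_deriv i g x + partial_deriv i f x * g x"
  by (subst partial_deriv_eq[OF has_derivative_mult[OF assms[THEN has_derivative_frechet]]])
     (simp add: partial_deriv_def)

lemma partial_deriv_cnj:
  assumes "f differentiable (at x)"
  shows "partial_deriv i (\<lambda>y. cnj (f y)) x = cnj (partial_deriv i f x)"
  by (subst partial_deriv_eq[OF has_derivative_cnj[OF assms[THEN has_derivative_frechet]]])
     (simp add: partial_deriv_def)

lemma has_derivative_translation:
  assumes "f differentiable (at (x - a))"
  shows "((\<lambda>y. f (y - a)) has_derivative frechet_derivative f (at (x - a))) (at x)"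
proof -
  have "((\<lambda>y. y - a) has_derivative (\<lambda>h. h)) (at x)"
    by (auto intro!: derivative_eq_intros)
  from has_derivative_compose[OF this has_derivative_frechet[OF assms]] show ?thesis
    by simp
qed

lemma partial_deriv_translation:
  assumes "f differentiable (at (x - a))"
  shows "partial_deriv i (\<lambda>y. f (y - a)) x = partial_deriv i f (x - a)"
  by (subst partial_deriv_eq[OF has_derivative_translation[OF assms]]) (simp add: partial_deriv_def)

lemma diff_order_add: "diff_order N f \<Longrightarrow> diff_order N g \<Longrightarrow> diff_order N (\<lambda>x. f x + g x)"
proof (induction N arbitrary: f g)
  case (Suc N)
  have "partial_deriv i (\<lambda>x. f x + g x) = (\<lambda>x. partial_deriv i f x + partial_deriv i g x)" for i
    using Suc.prems by (intro ext partial_deriv_add) (auto dest: diff_order_differentiable)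
  then show ?case using Suc by simp
qed simp

lemma diff_order_mult: "diff_order N f \<Longrightarrow> diff_order N g \<Longrightarrow> diff_order N (\<lambda>x. f x * g x)"
proof (induction N arbitrary: f g)
  case (Suc N)
  have "partial_deriv i (\<lambda>x. f x * g x) = (\<lambda>x. f x * partial_deriv i g x + partial_deriv i f x * g x)" for i
    using Suc.prems by (intro ext partial_deriv_mult) (auto dest: diff_order_differentiable)
  then show ?case using Suc by (auto intro!: diff_order_add)
qed simp

lemma diff_order_const: "diff_order N (\<lambda>x. c)"
proof (induction N arbitrary: c)
  case (Suc N)
  then show ?case by (simp add: partial_deriv_const)
qed simp

lemma diff_order_cnj: "diff_order N f \<Longrightarrow> diff_order N (\<lambda>x. cnj (f x))"
proof (induction N arbitrary: f)
  case 0
  then show ?case by (auto intro!: differentiableI[OF has_derivative_cnj[OF has_derivative_frechet]])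
next
  case (Suc N)
  have "partial_deriv i (\<lambda>x. cnj (f x)) = (\<lambda>x. cnj (partial_deriv i f x))" for i
    using Suc.prems by (intro ext partial_deriv_cnj) (auto dest: diff_order_differentiable)
  then show ?case using Suc by auto
qed

lemma diff_order_translation: "diff_order N f \<Longrightarrow> diff_order N (\<lambda>x. f (x - a))"
proof (induction N arbitrary: f)
  case 0
  then show ?case by (auto intro: differentiableI has_derivative_translation)
next
  case (Suc N)
  have "partial_deriv i (\<lambda>x. f (x - a)) = (\<lambda>x. partial_deriv i f (x - a))" for i
    using Suc.prems by (intro ext partial_deriv_translation) (auto dest: diff_order_differentiable)
  then show ?case using Suc by auto
qed

lemma smooth_add: "smooth f \<Longrightarrow> smooth g \<Longrightarrow> smooth (\<lambda>x. f x + g x)"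
  by (auto intro!: smoothI diff_order_add dest: smoothD)

lemma smooth_mult: "smooth f \<Longrightarrow> smooth g \<Longrightarrow> smooth (\<lambda>x. f x * g x)"
  by (auto intro!: smoothI diff_order_mult dest: smoothD)

lemma smooth_const: "smooth (\<lambda>x. c)"
  by (auto intro!: smoothI diff_order_const)

lemma smooth_cnj: "smooth f \<Longrightarrow> smooth (\<lambda>x. cnj (f x))"
  by (auto intro!: smoothI diff_order_cnj dest: smoothD)

lemma smooth_translation: "smooth f \<Longrightarrow> smooth (\<lambda>x. f (x - a))"
  by (auto intro!: smoothI diff_order_translation dest: smoothD)

text \<open>Lower derivatives are counted with multiplicity, which makes jets submultiplicative without a
  constant and bounds the jet of a character by an exact power.\<close>

fun jet :: "nat \<Rightarrow> (real^'n \<Rightarrow> complex) \<Rightarrow> real^'n \<Rightarrow> real" where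
  "jet 0 f x = norm (f x)"
| "jet (Suc N) f x = jet N f x + (\<Sum>i\<in>UNIV. jet N (partial_deriv i f) x)"

lemma jet_nonneg [simp]: "0 \<le> jet N f x"
  by (induction N arbitrary: f) (auto intro!: add_nonneg_nonneg sum_nonneg)

lemma jet_mono: "M \<le> N \<Longrightarrow> jet M f x \<le> jet N f x"
  by (rule lift_Suc_mono_le[of "\<lambda>N. jet N f x"]) (auto intro: sum_nonneg)

lemma norm_le_jet: "norm (f x) \<le> jet N f x"
  using jet_mono[of 0 N f x] by simp

lemma jet_partial_deriv_le: "jet N (partial_deriv i f) x \<le> jet (Suc N) f x"
proof -
  have "jet N (partial_deriv i f) x \<le> (\<Sum>i\<in>UNIV. jet N (partial_deriv i f) x)"
    by (rule member_le_sum) auto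
  then show ?thesis by (simp add: add_increasing)
qed

lemma norm_iter_partial_le_jet: "length is \<le> N \<Longrightarrow> norm (iter_partial is f x) \<le> jet N f x"
proof (induction "is" arbitrary: N f rule: rev_induct)
  case Nil
  then show ?case by (simp add: iter_partial_def norm_le_jet)
next
  case (snoc i "is")
  then obtain M where N: "N = Suc M" "length is \<le> M" by (cases N) auto
  show ?case unfolding iter_partial_snoc N
    using snoc.IH[OF N(2), of "partial_deriv i f"] jet_partial_deriv_le[of M i f x] by linarith
qed

lemma jet_add:
  assumes "smooth f" "smooth g"
  shows "jet N (\<lambda>x. f x + g x) x \<le> jet N f x + jet N g x"
  using assms
proof (induction N arbitrary: f g)
  case 0
  then show ?case by (simp add: norm_triangle_ineq)
next
  case (Suc N)
  have *: "partial_deriv i (\<lambda>x. f x + g x) = (\<lambda>x. partial_deriv i f x + partial_deriv i g x)" for i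
    using Suc.prems by (intro ext partial_deriv_add) (auto dest: smooth_differentiable)
  have "(\<Sum>i\<in>UNIV. jet N (\<lambda>x. partial_deriv i f x + partial_deriv i g x) x) \<le>
     (\<Sum>i\<in>UNIV. jet N (partial_deriv i f) x + jet N (partial_deriv i g) x)"
    using Suc by (intro sum_mono Suc.IH) (auto intro: smooth_partial_deriv)
  then show ?case using Suc.IH[OF Suc.prems] by (simp add: * sum.distrib)
qed

lemma jet_mult:
  assumes "smooth f" "smooth g"
  shows "jet N (\<lambda>x. f x * g x) x \<le> jet N f x * jet N g x"
  using assms
proof (induction N arbitrary: f g)
  case 0
  then show ?case by (simp add: norm_mult)
next
  case (Suc N)
  have *: "partial_deriv i (\<lambda>x. f x * g x) = (\<lambda>x. f x * partial_deriv i g x + partial_deriv i f x * g x)" for i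
    using Suc.prems by (intro ext partial_deriv_mult) (auto dest: smooth_differentiable)
  let ?F = "\<Sum>i\<in>UNIV. jet N (partial_deriv i f) x" and ?G = "\<Sum>i\<in>UNIV. jet N (partial_deriv i g) x"
  have "(\<Sum>i\<in>UNIV. jet N (\<lambda>x. f x * partial_deriv i g x + partial_deriv i f x * g x) x) \<le>
     (\<Sum>i\<in>UNIV. jet N f x * jet N (partial_deriv i g) x + jet N (partial_deriv i f) x * jet N g x)"
    using Suc by (intro sum_mono order_trans[OF jet_add] add_mono Suc.IH smooth_mult)
      (auto intro: smooth_partial_deriv)
  also have "\<dots> = jet N f x * ?G + ?F * jet N g x"
    by (simp add: sum.distrib sum_distrib_left sum_distrib_right)
  finally have "jet (Suc N) (\<lambda>x. f x * g x) x \<le> jet N f x * jet N g x + (jet N f x * ?G + ?F * jet N g x)"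
    using Suc.IH[OF Suc.prems] by (simp add: *)
  \<comment> \<open>The right side exceeds the left by the nonnegative product
    \<open>?F * ?G\<close>.\<close>
  also have "\<dots> \<le> jet (Suc N) f x * jet (Suc N) g x"
    by (simp add: algebra_simps sum_nonneg)
  finally show ?case .
qed

lemma jet_const: "jet N (\<lambda>x. c) x = norm c"
proof (induction N arbitrary: c)
  case (Suc N)
  then show ?case by (simp add: partial_deriv_const)
qed simp

lemma jet_cmult:
  assumes "smooth f"
  shows "jet N (\<lambda>x. c * f x) x \<le> norm c * jet N f x"
  using jet_mult[OF smooth_const assms, of N c] by (simp add: jet_const)

lemma jet_cnj:
  assumes "smooth f"
  shows "jet N (\<lambda>x. cnj (f x)) x = jet N f x"
  using assms
proof (induction N arbitrary: f)
  case (Suc N)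
  have *: "partial_deriv i (\<lambda>x. cnj (f x)) = (\<lambda>x. cnj (partial_deriv i f x))" for i
    using Suc.prems by (intro ext partial_deriv_cnj) (auto dest: smooth_differentiable)
  then show ?case using Suc by (simp add: smooth_partial_deriv)
qed simp

lemma jet_translation:
  assumes "smooth f"
  shows "jet N (\<lambda>x. f (x - a)) x = jet N f (x - a)"
  using assms
proof (induction N arbitrary: f)
  case (Suc N)
  have *: "partial_deriv i (\<lambda>x. f (x - a)) = (\<lambda>x. partial_deriv i f (x - a))" for i
    using Suc.prems by (intro ext partial_deriv_translation) (auto dest: smooth_differentiable)
  then show ?case using Suc by (simp add: smooth_partial_deriv)
qed simp

definition character :: "real^'n \<Rightarrow> real^'n \<Rightarrow> complex" where
  "character \<xi> y = exp (2 * of_real pi * \<i> * of_real (\<xi> \<bullet> y))"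

lemma norm_character [simp]: "norm (character \<xi> y) = 1"
  by (simp add: character_def norm_exp_eq_Re)

lemma character_cis: "character \<xi> y = cis (2 * pi * (\<xi> \<bullet> y))"
  by (simp add: character_def cis_conv_exp mult_ac)

lemma cnj_character: "cnj (character \<xi> y) = character (- \<xi>) y"
  by (simp add: character_cis cis_cnj)

lemma character_add: "character (\<xi> + \<eta>) y = character \<xi> y * character \<eta> y"
  by (simp add: character_cis cis_mult inner_add_left algebra_simps)

lemma character_add2: "character \<xi> (x + y) = character \<xi> x * character \<xi> y"
  by (simp add: character_cis cis_mult inner_add_right algebra_simps)

lemma continuous_on_character [continuous_intros]:
  "continuous_on S f \<Longrightarrow> continuous_on S g \<Longrightarrow> continuous_on S (\<lambda>x. character (f x) (g x))"
  unfolding character_def by (intro continuous_intros)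

lemma has_derivative_character:
  "(character \<xi> has_derivative (\<lambda>h. 2 * of_real pi * \<i> * of_real (\<xi> \<bullet> h) * character \<xi> x)) (at x)"
proof -
  have "((\<lambda>y. 2 * of_real pi * \<i> * of_real (\<xi> \<bullet> y)) has_derivative (\<lambda>h. 2 * of_real pi * \<i> * of_real (\<xi> \<bullet> h))) (at x)"
    by (auto intro!: derivative_eq_intros)
  from has_derivative_compose[OF this DERIV_exp[unfolded has_field_derivative_def]]
  show ?thesis unfolding character_def[abs_def] by (simp add: mult_ac)
qed

lemma partial_deriv_character:
  "partial_deriv i (character \<xi>) = (\<lambda>x. (2 * of_real pi * \<i> * of_real (\<xi> $ i)) * character \<xi> x)"
  by (rule ext, subst partial_deriv_eq[OF has_derivative_character]) (simp add: inner_axis)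

lemma smooth_character: "smooth (character \<xi>)"
proof (rule smoothI)
  fix N show "diff_order N (character \<xi>)"
  proof (induction N)
    case 0
    then show ?case by (auto intro: differentiableI has_derivative_character)
  next
    case (Suc N)
    then show ?case by (auto simp: partial_deriv_character intro!: diff_order_mult diff_order_const)
  qed
qed

text \<open>Every derivative multiplies the character by some 2 pi i xi_j, so one more order costs
  one factor of the weight. The same weight is gained per derivative in
  \<open>fourier_decay\<close>.\<close>

lemma jet_character: "jet N (character \<xi>) x \<le> (1 + (\<Sum>i\<in>UNIV. 2 * pi * \<bar>\<xi> $ i\<bar>)) ^ N"
proof (induction N)
  case (Suc N)
  have "jet (Suc N) (character \<xi>) x \<le> jet N (character \<xi>) x + (\<Sum>i\<in>UNIV. 2 * pi * \<bar>\<xi> $ i\<bar> * jet N (character \<xi>) x)"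
    unfolding jet.simps partial_deriv_character
    by (intro add_mono order_refl sum_mono order_trans[OF jet_cmult] smooth_character) (simp add: norm_mult)
  also have "\<dots> = (1 + (\<Sum>i\<in>UNIV. 2 * pi * \<bar>\<xi> $ i\<bar>)) * jet N (character \<xi>) x"
    by (simp only: sum_distrib_right distrib_right mult_1)
  also have "\<dots> \<le> (1 + (\<Sum>i\<in>UNIV. 2 * pi * \<bar>\<xi> $ i\<bar>)) ^ Suc N"
    unfolding power_Suc by (intro mult_left_mono Suc) (auto intro!: add_nonneg_nonneg sum_nonneg)
  finally show ?case .
qed simp

section \<open>Schwartz functions\<close>

lemma schwartz_smooth: "f \<in> schwartz \<Longrightarrow> smooth f"
  by (simp add: schwartz_def)

lemma schwartz_partial_deriv: "f \<in> schwartz \<Longrightarrow> partial_deriv i f \<in> schwartz"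
  unfolding schwartz_def by (auto simp: smooth_partial_deriv iter_partial_snoc[symmetric])

lemma schwartz_jet_bound:
  assumes "f \<in> schwartz"
  obtains B where "0 \<le> B" "\<And>x. jb x ^ k * jet N f x \<le> B"
proof -
  have "\<exists>B. \<forall>x. jb x ^ k * jet N f x \<le> B" using assms
  proof (induction N arbitrary: f)
    case 0
    then have "bdd_above (range (\<lambda>x. jb x ^ k * norm (iter_partial [] f x)))"
      by (simp add: schwartz_def)
    then show ?case by (auto simp: iter_partial_def bdd_above_def)
  next
    case (Suc N)
    obtain B where B: "\<And>x. jb x ^ k * jet N f x \<le> B" using Suc by blast
    have "\<forall>i. \<exists>B. \<forall>x. jb x ^ k * jet N (partial_deriv i f) x \<le> B"
      using Suc by (auto intro: schwartz_partial_deriv)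
    then obtain C where C: "\<And>i x. jb x ^ k * jet N (partial_deriv i f) x \<le> C i" by metis
    have "jb x ^ k * jet (Suc N) f x \<le> B + (\<Sum>i\<in>UNIV. C i)" for x
      unfolding jet.simps distrib_left sum_distrib_left by (intro add_mono sum_mono B C)
    then show ?case by blast
  qed
  then obtain B where B: "\<And>x. jb x ^ k * jet N f x \<le> B" by blast
  show ?thesis
    by (rule that[OF _ B]) (rule order_trans[OF _ B[of 0]], simp)
qed

text \<open>One number can serve as decay power and as order of differentiation, because powers of
  \<open>jb\<close> and jets both increase with it: the maximum of a pair covers the pair.\<close>

lemma schwartzI:
  fixes f :: "real^'n \<Rightarrow> complex"
  assumes "smooth f" "\<And>N. \<exists>B. \<forall>x. jb x ^ N * jet N f x \<le> B"
  shows "f \<in> schwartz"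
  unfolding schwartz_def
proof (intro CollectI conjI allI)
  fix k and "is" :: "'n list"
  obtain B where B: "\<And>x. jb x ^ max k (length is) * jet (max k (length is)) f x \<le> B"
    using assms(2) by blast
  have "jb x ^ k * norm (iter_partial is f x) \<le> B" for x
    by (rule order_trans[OF mult_mono B[of x]]) (auto intro!: power_increasing norm_iter_partial_le_jet)
  then show "bdd_above (range (\<lambda>x. jb x ^ k * norm (iter_partial is f x)))"
    by (auto simp: bdd_above_def)
qed fact

lemma schwartz_mult:
  assumes "f \<in> schwartz" "smooth g" "\<And>N. \<exists>B. \<forall>x. jet N g x \<le> B"
  shows "(\<lambda>x. f x * g x) \<in> schwartz"
proof (rule schwartzI)
  fix N
  obtain B where B: "0 \<le> B" "\<And>x. jb x ^ N * jet N f x \<le> B"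
    using schwartz_jet_bound[OF assms(1), of N N] by blast
  obtain C where C: "\<And>x. jet N g x \<le> C" using assms(3) by blast
  have "jb x ^ N * jet N (\<lambda>x. f x * g x) x \<le> B * C" for x
  proof -
    have "jb x ^ N * jet N (\<lambda>x. f x * g x) x \<le> jb x ^ N * (jet N f x * jet N g x)"
      by (intro mult_left_mono jet_mult) (auto intro: assms schwartz_smooth)
    also have "\<dots> \<le> B * C"
      unfolding mult.assoc[symmetric] by (intro mult_mono B C) auto
    finally show ?thesis .
  qed
  then show "\<exists>B. \<forall>x. jb x ^ N * jet N (\<lambda>x. f x * g x) x \<le> B" by blast
qed (auto intro!: smooth_mult assms intro: schwartz_smooth)

lemma schwartz_jet_bounded: "f \<in> schwartz \<Longrightarrow> \<exists>B. \<forall>x. jet N f x \<le> B"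
  using schwartz_jet_bound[of f 0 N] by (metis mult_1 power_0)

lemma schwartz_cmult: "f \<in> schwartz \<Longrightarrow> (\<lambda>x. c * f x) \<in> schwartz"
  using schwartz_mult[of f "\<lambda>x. c"] by (simp add: smooth_const jet_const mult.commute) blast

lemma schwartz_add:
  assumes "f \<in> schwartz" "g \<in> schwartz"
  shows "(\<lambda>x. f x + g x) \<in> schwartz"
proof (rule schwartzI)
  fix N
  obtain B where B: "0 \<le> B" "\<And>x. jb x ^ N * jet N f x \<le> B"
    using schwartz_jet_bound[OF assms(1), of N N] by blast
  obtain C where C: "0 \<le> C" "\<And>x. jb x ^ N * jet N g x \<le> C"
    using schwartz_jet_bound[OF assms(2), of N N] by blast
  have "jb x ^ N * jet N (\<lambda>x. f x + g x) x \<le> B + C" for x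
  proof -
    have "jb x ^ N * jet N (\<lambda>x. f x + g x) x \<le> jb x ^ N * (jet N f x + jet N g x)"
      by (intro mult_left_mono jet_add) (auto intro: assms schwartz_smooth)
    then show ?thesis using B(2)[of x] C(2)[of x] by (simp add: distrib_left)
  qed
  then show "\<exists>B. \<forall>x. jb x ^ N * jet N (\<lambda>x. f x + g x) x \<le> B" by blast
qed (auto intro!: smooth_add intro: schwartz_smooth assms)

lemma schwartz_zero: "(\<lambda>x. 0) \<in> schwartz"
  by (rule schwartzI) (auto simp: smooth_const jet_const)

lemma schwartz_sum: "(\<And>i. i \<in> I \<Longrightarrow> f i \<in> schwartz) \<Longrightarrow> (\<lambda>x. \<Sum>i\<in>I. f i x) \<in> schwartz"
  by (induction I rule: infinite_finite_induct) (auto intro: schwartz_add schwartz_zero)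

lemma jet_sum:
  "(\<And>i. i \<in> I \<Longrightarrow> f i \<in> schwartz) \<Longrightarrow> jet N (\<lambda>x. \<Sum>i\<in>I. f i x) x \<le> (\<Sum>i\<in>I. jet N (f i) x)"
proof (induction I rule: infinite_finite_induct)
  case (insert i I)
  have "jet N (\<lambda>x. f i x + (\<Sum>i\<in>I. f i x)) x \<le> jet N (f i) x + jet N (\<lambda>x. \<Sum>i\<in>I. f i x) x"
    using insert by (intro jet_add schwartz_smooth schwartz_sum) auto
  then show ?case using insert by fastforce
qed (auto simp: jet_const)

lemma schwartz_cnj: "f \<in> schwartz \<Longrightarrow> (\<lambda>x. cnj (f x)) \<in> schwartz"
  by (rule schwartzI) (auto simp: jet_cnj schwartz_smooth smooth_cnj intro: schwartz_jet_bound)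

text \<open>Peetre's inequality for x = (x - a) + a puts the weight onto the function and leaves
  \<open>jb a ^ N\<close>. Uniformity in \<open>a\<close> matters because translations by
  arbitrarily large vectors are later summed.\<close>

lemma jet_translation_bound:
  assumes "f \<in> schwartz"
  shows "\<exists>B\<ge>0. \<forall>x a. jb x ^ N * jet N (\<lambda>x. f (x - a)) x \<le> B * jb a ^ N"
proof -
  obtain B where B: "0 \<le> B" "\<And>x. jb x ^ N * jet N f x \<le> B"
    using schwartz_jet_bound[OF assms, of N N] by blast
  have "jb x ^ N * jet N (\<lambda>x. f (x - a)) x \<le> (2 ^ N * B) * jb a ^ N" for x a
  proof -
    have "jb x ^ N \<le> (2 * jb (x - a) * jb a) ^ N"
      using jb_peetre[of "x - a" a] by (intro power_mono) auto
    then have "jb x ^ N * jet N f (x - a) \<le> (2 * jb (x - a) * jb a) ^ N * jet N f (x - a)"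
      by (intro mult_right_mono) auto
    also have "\<dots> = 2 ^ N * jb a ^ N * (jb (x - a) ^ N * jet N f (x - a))"
      by (simp add: power_mult_distrib)
    also have "\<dots> \<le> 2 ^ N * jb a ^ N * B"
      by (intro mult_left_mono B) auto
    finally show ?thesis
      by (simp add: jet_translation schwartz_smooth assms mult_ac)
  qed
  then show ?thesis using B(1) by (intro exI[of _ "2 ^ N * B"]) auto
qed

lemma schwartz_translation:
  assumes "f \<in> schwartz"
  shows "(\<lambda>x. f (x - a)) \<in> schwartz"
proof (rule schwartzI)
  fix N
  obtain B where "\<And>x a. jb x ^ N * jet N (\<lambda>x. f (x - a)) x \<le> B * jb a ^ N"
    using jet_translation_bound[OF assms, of N] by blast
  then show "\<exists>B. \<forall>x. jb x ^ N * jet N (\<lambda>x. f (x - a)) x \<le> B"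
    by (intro exI[of _ "B * jb a ^ N"] allI)
qed (auto intro: smooth_translation schwartz_smooth assms)

lemma character_weight_le:
  fixes \<xi> :: "real^'n"
  shows "1 + (\<Sum>i\<in>UNIV. 2 * pi * \<bar>\<xi> $ i\<bar>) \<le> (1 + 2 * pi * CARD('n)) * jb \<xi>"
proof -
  have "(\<Sum>i\<in>UNIV. 2 * pi * \<bar>\<xi> $ i\<bar>) \<le> (\<Sum>i\<in>(UNIV::'n set). 2 * pi * jb \<xi>)"
    using component_le_norm_cart[of \<xi>] norm_le_jb[of \<xi>]
    by (intro sum_mono mult_left_mono) (auto intro: order_trans)
  then have "(\<Sum>i\<in>UNIV. 2 * pi * \<bar>\<xi> $ i\<bar>) \<le> 2 * pi * CARD('n) * jb \<xi>"
    by (simp add: mult_ac)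
  then show ?thesis using jb_ge_1[of \<xi>] unfolding distrib_right mult_1 by linarith
qed

lemma tf_shift_eq: "tf_shift z f = (\<lambda>y. f (y - fst z) * character (snd z) y)"
  by (auto simp: tf_shift_def modulation_def translation_def character_def)

lemma schwartz_tf_shift: "f \<in> schwartz \<Longrightarrow> tf_shift z f \<in> schwartz"
  unfolding tf_shift_eq
  by (intro schwartz_mult schwartz_translation smooth_character) (auto intro: jet_character)

text \<open>Half of the exponent \<open>2 * N\<close> comes from the translation, half from
  differentiating the character. This turns moments of coefficients into Schwartz bounds for sums of
  time-frequency shifts.\<close>

lemma jet_tf_shift_bound:
  fixes f :: "real^'n \<Rightarrow> complex"
  assumes "f \<in> schwartz"
  shows "\<exists>B\<ge>0. \<forall>x z. jb x ^ N * jet N (tf_shift z f) x \<le> B * jb z ^ (2 * N)"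
proof -
  obtain B where B: "0 \<le> B" "\<And>x a. jb x ^ N * jet N (\<lambda>x. f (x - a)) x \<le> B * jb a ^ N"
    using jet_translation_bound[OF assms, of N] by blast
  let ?C = "1 + 2 * pi * CARD('n)"
  have "jb x ^ N * jet N (tf_shift z f) x \<le> (B * ?C ^ N) * jb z ^ (2 * N)" for x z
  proof -
    have "jb x ^ N * jet N (tf_shift z f) x \<le>
        jb x ^ N * (jet N (\<lambda>x. f (x - fst z)) x * jet N (character (snd z)) x)"
      unfolding tf_shift_eq
      by (intro mult_left_mono jet_mult smooth_character smooth_translation schwartz_smooth assms) simp
    also have "\<dots> \<le> (B * jb (fst z) ^ N) * (?C * jb (snd z)) ^ N"
      unfolding mult.assoc[symmetric]
      by (intro mult_mono B order_trans[OF jet_character] power_mono character_weight_le)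
        (auto intro!: B add_nonneg_nonneg sum_nonneg mult_nonneg_nonneg)
    also have "\<dots> \<le> (B * jb z ^ N) * (?C * jb z) ^ N"
      by (intro mult_mono power_mono jb_fst jb_snd mult_left_mono) (auto intro!: B mult_nonneg_nonneg)
    also have "\<dots> = (B * ?C ^ N) * jb z ^ (2 * N)"
      unfolding mult_2[of N] power_add power_mult_distrib by (simp only: mult_ac)
    finally show ?thesis .
  qed
  moreover have "0 \<le> B * ?C ^ N"
    by (intro mult_nonneg_nonneg B zero_le_power add_nonneg_nonneg) simp_all
  ultimately show ?thesis by blast
qed


section \<open>Derivatives, finite differences and bounded sequences of Schwartz functions\<close>

lemma norm_frechet_derivative_le:
  assumes "f differentiable (at x)"
  shows "norm (frechet_derivative f (at x) h) \<le> jet 1 f x * norm h"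
proof -
  let ?D = "frechet_derivative f (at x)"
  have lin: "linear ?D" by (rule linear_frechet_derivative[OF assms])
  have "?D h = ?D (\<Sum>i\<in>UNIV. h $ i *\<^sub>R axis i 1)"
    using basis_expansion[of h] by (simp add: scalar_mult_eq_scaleR)
  also have "\<dots> = (\<Sum>i\<in>UNIV. h $ i *\<^sub>R partial_deriv i f x)"
    by (simp add: linear_sum[OF lin] linear_scale[OF lin] partial_deriv_def)
  also have "norm \<dots> \<le> (\<Sum>i\<in>UNIV. norm h * norm (partial_deriv i f x))"
    by (rule norm_sum[THEN order_trans]) (auto intro!: sum_mono mult_right_mono component_le_norm_cart)
  also have "\<dots> \<le> jet 1 f x * norm h"
    by (simp add: sum_distrib_left[symmetric] algebra_simps)
  finally show ?thesis .
qed

lemma jet_lipschitz: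
  assumes "smooth f" "\<And>x. jet 1 f x \<le> B"
  shows "norm (f x - f y) \<le> B * norm (x - y)"
proof (rule differentiable_bound[of UNIV f "\<lambda>x. frechet_derivative f (at x)"])
  show "(f has_derivative frechet_derivative f (at x)) (at x within UNIV)" for x
    using assms(1) by (simp add: has_derivative_frechet smooth_differentiable)
  have "0 \<le> B" using assms(2)[of 0] jet_nonneg[of 1 f 0] by linarith
  then show "onorm (frechet_derivative f (at x)) \<le> B" for x
    by (intro onorm_bound order_trans[OF norm_frechet_derivative_le] mult_right_mono assms smooth_differentiable) auto
qed auto

lemma has_vector_derivative_partial_deriv:
  assumes "smooth f"
  shows "((\<lambda>s. f (x + s *\<^sub>R axis i 1)) has_vector_derivative partial_deriv i f (x + s *\<^sub>R axis i 1)) (at s within S)"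
proof -
  have "((\<lambda>s. x + s *\<^sub>R axis i 1) has_derivative (\<lambda>r. r *\<^sub>R axis i 1)) (at s within S)"
    by (auto intro!: derivative_eq_intros)
  from has_derivative_compose[OF this has_derivative_frechet[OF smooth_differentiable[OF assms]]]
  show ?thesis unfolding has_vector_derivative_def
    by (simp add: linear_scale[OF linear_frechet_derivative[OF smooth_differentiable[OF assms]]] partial_deriv_def)
qed

text \<open>Subtracting the linear part leaves a function of \<open>s\<close> whose derivative is a
  difference of two values of \<open>partial_deriv i f\<close>, at most \<open>B * t\<close> by the
  Lipschitz bound from second derivatives. The mean value inequality then gives the second factor
  \<open>t\<close>.\<close>

lemma partial_deriv_remainder:
  assumes "smooth f" "\<And>x. jet 2 f x \<le> B" "0 < t"
  shows "norm (f (x + t *\<^sub>R axis i 1) - f x - t *\<^sub>R partial_deriv i f x) \<le> B * t * t"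
proof -
  define g where "g s = f (x + s *\<^sub>R axis i 1) - s *\<^sub>R partial_deriv i f x" for s
  define D where "D s = partial_deriv i f (x + s *\<^sub>R axis i 1) - partial_deriv i f x" for s
  have lip: "norm (partial_deriv i f a - partial_deriv i f b) \<le> B * norm (a - b)" for a b
    using assms(2) jet_partial_deriv_le[of 1 i f]
    by (intro jet_lipschitz smooth_partial_deriv assms) (auto simp: numeral_2_eq_2 intro: order_trans)
  have "0 \<le> B" using assms(2)[of 0] jet_nonneg[of 2 f 0] by linarith
  have "norm (g t - g 0) \<le> (B * t) * norm (t - 0)"
  proof (rule differentiable_bound[of "{0..t}" g "\<lambda>s r. r *\<^sub>R D s"])
    show "(g has_derivative (\<lambda>r. r *\<^sub>R D s)) (at s within {0..t})" if "s \<in> {0..t}" for s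
      unfolding g_def D_def has_vector_derivative_def[symmetric]
      by (intro derivative_intros has_vector_derivative_partial_deriv[OF assms(1)])
        (auto intro!: derivative_eq_intros)
    show "onorm (\<lambda>r. r *\<^sub>R D s) \<le> B * t" if "s \<in> {0..t}" for s
    proof (rule onorm_bound)
      have "norm (D s) \<le> B * norm (s *\<^sub>R axis i (1::real))"
        unfolding D_def using lip[of "x + s *\<^sub>R axis i 1" x] by simp
      also have "\<dots> \<le> B * t" using that \<open>0 \<le> B\<close> by (intro mult_left_mono) auto
      finally show "norm (r *\<^sub>R D s) \<le> B * t * norm r" for r
        by (simp add: mult.commute[of _ "\<bar>r\<bar>"] mult_left_mono)
    qed (use \<open>0 \<le> B\<close> assms in auto)
  qed (use assms in auto)
  then show ?thesis
    using assms(3) by (simp add: g_def algebra_simps)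
qed

text \<open>Small values together with bounded second derivatives force small first derivatives: the
  free increment \<open>t\<close> balances the two contributions.\<close>

lemma norm_partial_deriv_le_quotient:
  assumes "smooth f" "\<And>x. jet 2 f x \<le> B" "0 < t"
  shows "norm (partial_deriv i f x) \<le> norm (f (x + t *\<^sub>R axis i 1) - f x) / t + B * t"
proof -
  note * = partial_deriv_remainder[OF assms, of x i]
  have "t * norm (partial_deriv i f x) = norm (t *\<^sub>R partial_deriv i f x)"
    using assms(3) by simp
  also have "\<dots> \<le> norm (f (x + t *\<^sub>R axis i 1) - f x) + B * t * t"
    using * norm_triangle_ineq4[of "f (x + t *\<^sub>R axis i 1) - f x" "f (x + t *\<^sub>R axis i 1) - f x - t *\<^sub>R partial_deriv i f x"]
    by simp
  finally show ?thesis
    using assms(3) by (simp add: field_simps)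
qed

text \<open>Boundedness in the sense of the locally convex space: every seminorm is bounded
  uniformly in \<open>k\<close>. As in \<open>schwartzI\<close>, one \<open>N\<close> governs weight
  and order.\<close>

definition schwartz_bounded :: "(nat \<Rightarrow> real^'n \<Rightarrow> complex) \<Rightarrow> bool" where
  "schwartz_bounded F \<longleftrightarrow> (\<forall>k. F k \<in> schwartz) \<and> (\<forall>N. \<exists>B. \<forall>k x. jb x ^ N * jet N (F k) x \<le> B)"

lemma schwartz_boundedD:
  assumes "schwartz_bounded F"
  shows "F k \<in> schwartz" "\<exists>B. \<forall>k x. jb x ^ M * jet N (F k) x \<le> B"
proof -
  show "F k \<in> schwartz" using assms by (simp add: schwartz_bounded_def)
  obtain B where B: "\<And>k x. jb x ^ max M N * jet (max M N) (F k) x \<le> B"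
    using assms unfolding schwartz_bounded_def by blast
  have "jb x ^ M * jet N (F k) x \<le> B" for k x
    by (rule order_trans[OF mult_mono B[of x k]]) (auto intro!: power_increasing jet_mono)
  then show "\<exists>B. \<forall>k x. jb x ^ M * jet N (F k) x \<le> B" by blast
qed

lemma schwartz_bounded_jet: "schwartz_bounded F \<Longrightarrow> \<exists>B. \<forall>k x. jet N (F k) x \<le> B"
  using schwartz_boundedD(2)[of F 0 N] by simp

lemma schwartz_bounded_partial_deriv:
  assumes "schwartz_bounded F"
  shows "schwartz_bounded (\<lambda>k. partial_deriv i (F k))"
  unfolding schwartz_bounded_def
proof (intro conjI allI)
  fix N
  obtain B where B: "\<And>k x. jb x ^ N * jet (Suc N) (F k) x \<le> B"
    using schwartz_boundedD(2)[OF assms] by blast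
  have "jb x ^ N * jet N (partial_deriv i (F k)) x \<le> B" for k x
    by (rule order_trans[OF mult_left_mono B[of x k]]) (auto intro!: jet_partial_deriv_le simp del: jet.simps)
  then show "\<exists>B. \<forall>k x. jb x ^ N * jet N (partial_deriv i (F k)) x \<le> B" by blast
qed (intro schwartz_partial_deriv schwartz_boundedD(1)[OF assms])

text \<open>The increment \<open>t\<close> is fixed first, making the second-order error small
  uniformly in \<open>k\<close>; after that only two points remain, where pointwise convergence
  applies.\<close>

lemma pointwise_null_partial_deriv:
  assumes "schwartz_bounded F" "\<And>x. (\<lambda>k. F k x) \<longlonglongrightarrow> 0"
  shows "(\<lambda>k. partial_deriv i (F k) x) \<longlonglongrightarrow> 0"
proof (rule LIMSEQ_I)
  fix \<epsilon> :: real assume "0 < \<epsilon>"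
  obtain B where B: "\<And>k x. jet 2 (F k) x \<le> B"
    using schwartz_bounded_jet[OF assms(1)] by blast
  have "0 \<le> B" using B[of 0 0] jet_nonneg[of 2 "F 0" 0] by linarith
  \<comment> \<open>\<open>B + 1\<close> keeps the quotient meaningful for \<open>B = 0\<close> and
    gives \<open>B * t\<close> less than half of the tolerance.\<close>
  define t where "t = \<epsilon> / (2 * (B + 1))"
  have t: "0 < t" "B * t < \<epsilon>"
    using \<open>0 < \<epsilon>\<close> \<open>0 \<le> B\<close> by (auto simp: t_def field_simps intro: add_nonneg_pos)
  have "(\<lambda>k. norm (F k (x + t *\<^sub>R axis i 1) - F k x) / t + B * t) \<longlonglongrightarrow> norm (0 - 0::complex) / t + B * t"
    using t(1) by (intro tendsto_intros assms) simp
  then have "eventually (\<lambda>k. norm (F k (x + t *\<^sub>R axis i 1) - F k x) / t + B * t < \<epsilon>) sequentially"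
    using t by (intro order_tendstoD(2)[of _ "B * t"]) simp_all
  then have "eventually (\<lambda>k. norm (partial_deriv i (F k) x - 0) < \<epsilon>) sequentially"
  proof eventually_elim
    case (elim k)
    then show ?case
      using norm_partial_deriv_le_quotient[of "F k" B t i x] B t(1)
        schwartz_smooth[OF schwartz_boundedD(1)[OF assms(1)]] by simp
  qed
  then show "\<exists>no. \<forall>k\<ge>no. norm (partial_deriv i (F k) x - 0) < \<epsilon>"
    by (simp add: eventually_sequentially)
qed

text \<open>Equicontinuity and decay upgrade pointwise convergence to weighted uniform convergence.\<close>

lemma pointwise_null_weighted_uniform:
  fixes F :: "nat \<Rightarrow> real^'n \<Rightarrow> complex"
  assumes "schwartz_bounded F" "\<And>x. (\<lambda>k. F k x) \<longlonglongrightarrow> 0" "0 < \<epsilon>"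
  shows "eventually (\<lambda>k. \<forall>x. jb x ^ M * norm (F k x) \<le> \<epsilon>) sequentially"
proof (rule ccontr)
  assume "\<not> ?thesis"
  from not_eventually_sequentiallyD[OF this]
  obtain r :: "nat \<Rightarrow> nat" where r: "strict_mono r" "\<And>k. \<exists>x. \<not> jb x ^ M * norm (F (r k) x) \<le> \<epsilon>" by auto
  then obtain x where x: "\<And>k. \<epsilon> < jb (x k) ^ M * norm (F (r k) (x k))"
    by (metis not_le)
  \<comment> \<open>One power more than in the claim: the spare factor confines the bad points
    \<open>x k\<close> to the ball of radius \<open>B / \<epsilon>\<close>.\<close>
  obtain B where B: "\<And>k x. jb x ^ Suc M * jet 0 (F k) x \<le> B"
    using schwartz_boundedD(2)[OF assms(1)] by blast
  define Q where "Q = B / \<epsilon>"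
  have Q: "jb (x k) \<le> Q" for k
  proof -
    have "jb (x k) * \<epsilon> \<le> jb (x k) * (jb (x k) ^ M * norm (F (r k) (x k)))"
      using x[of k] by (intro mult_left_mono) auto
    also have "\<dots> \<le> B" using B[of "x k" "r k"] by (simp add: mult_ac)
    finally show ?thesis using assms(3) by (simp add: Q_def field_simps)
  qed
  then have "1 \<le> Q" using jb_ge_1[of "x 0"] by (meson order_trans)
  have "x k \<in> cball 0 Q" for k
    using norm_le_jb[of "x k"] Q[of k] by simp
  then obtain l s where s: "strict_mono s" "(x \<circ> s) \<longlonglongrightarrow> l"
    using compact_cball[of "0::real^'n" Q] unfolding compact_def by metis
  obtain C where C: "\<And>k x. jet 1 (F k) x \<le> C"
    using schwartz_bounded_jet[OF assms(1)] by blast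
  \<comment> \<open>The common Lipschitz constant \<open>C\<close> replaces the moving points by
    their limit \<open>l\<close>, where pointwise convergence gives the contradiction.\<close>
  have "\<epsilon> \<le> Q ^ M * (norm (F (r (s k)) l) + C * norm (x (s k) - l))" for k
  proof -
    have "norm (F (r (s k)) (x (s k))) \<le> norm (F (r (s k)) l) + norm (F (r (s k)) (x (s k)) - F (r (s k)) l)"
      by (metis add.commute diff_add_cancel norm_triangle_ineq)
    also have "\<dots> \<le> norm (F (r (s k)) l) + C * norm (x (s k) - l)"
      using C by (intro add_left_mono jet_lipschitz schwartz_smooth schwartz_boundedD(1)[OF assms(1)])
    finally have "jb (x (s k)) ^ M * norm (F (r (s k)) (x (s k))) \<le> Q ^ M * (norm (F (r (s k)) l) + C * norm (x (s k) - l))"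
      using Q \<open>1 \<le> Q\<close> by (intro mult_mono power_mono) auto
    then show ?thesis using x[of "s k"] by linarith
  qed
  moreover have "(\<lambda>k. Q ^ M * (norm (F (r (s k)) l) + C * norm (x (s k) - l))) \<longlonglongrightarrow> Q ^ M * (norm (0::complex) + C * norm (l - l))"
    using LIMSEQ_subseq_LIMSEQ[OF assms(2)[of l] strict_mono_o[OF r(1) s(1)]] s(2)
    by (intro tendsto_intros) (auto simp: o_def)
  ultimately have "\<epsilon> \<le> Q ^ M * (norm (0::complex) + C * norm (l - l))"
    by (intro LIMSEQ_le_const) auto
  then show False using assms(3) by simp
qed

lemma pointwise_null_jet_uniform:
  assumes "schwartz_bounded F" "\<And>x. (\<lambda>k. F k x) \<longlonglongrightarrow> 0" "0 < \<epsilon>"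
  shows "eventually (\<lambda>k. \<forall>x. jb x ^ M * jet N (F k) x \<le> \<epsilon>) sequentially"
  using assms
proof (induction N arbitrary: F \<epsilon>)
  case 0
  then show ?case using pointwise_null_weighted_uniform[of F \<epsilon> M] by simp
next
  case (Suc N)
  \<comment> \<open>Half of the tolerance goes to the lower orders; the other half is shared equally
    by the partial derivatives, one per coordinate.\<close>
  let ?c = "\<epsilon> / (2 * CARD('a))"
  have c: "0 < ?c" using Suc.prems(3) by simp
  have "eventually (\<lambda>k. \<forall>x. jb x ^ M * jet N (F k) x \<le> \<epsilon> / 2) sequentially"
    by (rule Suc.IH[OF Suc.prems(1,2)]) (use Suc.prems in simp)
  moreover have "eventually (\<lambda>k. \<forall>i\<in>UNIV. \<forall>x. jb x ^ M * jet N (partial_deriv i (F k)) x \<le> ?c) sequentially"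
    using Suc.prems by (intro eventually_ball_finite ballI Suc.IH[OF schwartz_bounded_partial_deriv]
      pointwise_null_partial_deriv c) auto
  ultimately show ?case
  proof eventually_elim
    case (elim k)
    show ?case
    proof
      fix x
      have "(\<Sum>i\<in>UNIV. jb x ^ M * jet N (partial_deriv i (F k)) x) \<le> (\<Sum>i\<in>(UNIV::'a set). ?c)"
        using elim by (intro sum_mono) auto
      then have "(\<Sum>i\<in>UNIV. jb x ^ M * jet N (partial_deriv i (F k)) x) \<le> \<epsilon> / 2" by simp
      with elim(1)[rule_format, of x] show "jb x ^ M * jet (Suc N) (F k) x \<le> \<epsilon>"
        by (simp add: distrib_left sum_distrib_left)
    qed
  qed
qed

section \<open>Temperate distributions\<close>

lemma temperate_add:
  "temperate_distribution u \<Longrightarrow> f \<in> schwartz \<Longrightarrow> g \<in> schwartz \<Longrightarrow> u (\<lambda>x. f x + g x) = u f + u g"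
  unfolding temperate_distribution_def by blast

lemma temperate_cmult:
  "temperate_distribution u \<Longrightarrow> f \<in> schwartz \<Longrightarrow> u (\<lambda>x. c * f x) = c * u f"
  unfolding temperate_distribution_def by blast

lemma temperate_zero: "temperate_distribution u \<Longrightarrow> u (\<lambda>x. 0) = 0"
  using temperate_cmult[OF _ schwartz_zero, of u 0] by simp

lemma temperate_sum:
  assumes "temperate_distribution u" "\<And>v. v \<in> I \<Longrightarrow> f v \<in> schwartz"
  shows "u (\<lambda>x. \<Sum>v\<in>I. a v * f v x) = (\<Sum>v\<in>I. a v * u (f v))"
  using assms(2)
proof (induction I rule: infinite_finite_induct)
  case (insert v I)
  then show ?case
    by (simp add: temperate_add[OF assms(1)] temperate_cmult[OF assms(1)] schwartz_cmult schwartz_sum)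
qed (auto simp: temperate_zero[OF assms(1)])

text \<open>Continuity at 0 provides a ball mapped into the unit disc, and homogeneity rescales this
  to an estimate. \<open>B\<close> is a free number instead of a supremum, so that any available
  majorant can be inserted.\<close>

lemma temperate_bound:
  fixes u :: "(real^'n \<Rightarrow> complex) \<Rightarrow> complex"
  assumes "temperate_distribution u"
  shows "\<exists>N C. 0 \<le> C \<and> (\<forall>f\<in>schwartz. \<forall>B. (\<forall>x. jb x ^ N * jet N f x \<le> B) \<longrightarrow> norm (u f) \<le> C * B)"
proof -
  let ?U = "{f \<in> topspace schwartz_topology. u f \<in> ball 0 1}"
  have "openin schwartz_topology ?U"
    using assms unfolding temperate_distribution_def
    by (intro openin_continuous_map_preimage[of _ euclidean]) auto
  moreover have "(\<lambda>x. 0) \<in> ?U"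
    by (simp add: topspace_schwartz_topology schwartz_zero temperate_zero[OF assms])
  ultimately obtain N e where e: "0 < e" and sub: "schwartz_ball (\<lambda>x. 0) N e \<subseteq> ?U"
    unfolding openin_schwartz_topology by blast
  have "norm (u f) \<le> 2 / e * B" if f: "f \<in> schwartz" and B: "\<And>x. jb x ^ N * jet N f x \<le> B" for f B
  proof -
    have "0 \<le> B" by (rule order_trans[OF _ B[of 0]]) simp
    have "norm (u f) * e / 2 \<le> B"
    proof (rule dense_ge)
      fix B' assume "B < B'"
      \<comment> \<open>Scaling with \<open>B'\<close> strictly above \<open>B\<close> also covers
        \<open>B = 0\<close>. The factor 2 leaves room for the supremum: values below
        \<open>e\<close> alone would not make it less than \<open>e\<close>.\<close>
      define c where "c = e / (2 * B')"
      have "0 < B'" using \<open>B < B'\<close> \<open>0 \<le> B\<close> by simp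
      then have "0 < c" using e by (simp add: c_def)
      let ?g = "\<lambda>x. complex_of_real c * f x"
      have g: "?g \<in> schwartz" by (intro schwartz_cmult f)
      have "schwartz_seminorm k is (\<lambda>x. ?g x - 0) < e" if "k \<le> N" "length is \<le> N" for k "is"
      proof -
        have "jb x ^ k * norm (iter_partial is ?g x) \<le> e / 2" for x
        proof -
          have "jb x ^ k * norm (iter_partial is ?g x) \<le> jb x ^ N * jet N ?g x"
            using that by (intro mult_mono power_increasing norm_iter_partial_le_jet) auto
          also have "\<dots> \<le> jb x ^ N * (norm (complex_of_real c) * jet N f x)"
            by (intro mult_left_mono jet_cmult schwartz_smooth f) auto
          also have "\<dots> = c * (jb x ^ N * jet N f x)"
            using \<open>0 < c\<close> by simp
          also have "\<dots> \<le> c * B'"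
            using \<open>0 < c\<close> \<open>B < B'\<close> B[of x] by (intro mult_left_mono) auto
          also have "\<dots> = e / 2" using \<open>0 < B'\<close> by (simp add: c_def)
          finally show ?thesis .
        qed
        then have "schwartz_seminorm k is (\<lambda>x. ?g x - 0) \<le> e / 2"
          unfolding schwartz_seminorm_def by (intro cSUP_least) auto
        then show ?thesis using e by simp
      qed
      then have "?g \<in> schwartz_ball (\<lambda>x. 0) N e"
        using g by (simp add: schwartz_ball_def)
      then have "norm (u ?g) < 1" using sub by auto
      then have "c * norm (u f) < 1"
        using temperate_cmult[OF assms f, of "complex_of_real c"] \<open>0 < c\<close> by (simp add: norm_mult)
      then show "norm (u f) * e / 2 \<le> B'"
        using \<open>0 < B'\<close> by (simp add: c_def field_simps)
    qed
    then show ?thesis using e by (simp add: field_simps)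
  qed
  then show ?thesis using e by (intro exI[of _ N] exI[of _ "2 / e"]) auto
qed

text \<open>The difference from the limit is again bounded and pointwise null, hence uniformly small
  in the single weighted jet that dominates \<open>u\<close>.\<close>

lemma temperate_tendsto:
  assumes u: "temperate_distribution u" and F: "schwartz_bounded F" and f: "f \<in> schwartz"
    and lim: "\<And>x. (\<lambda>k. F k x) \<longlonglongrightarrow> f x"
  shows "(\<lambda>k. u (F k)) \<longlonglongrightarrow> u f"
proof -
  let ?G = "\<lambda>k x. F k x + (-1) * f x"
  have mf: "(\<lambda>x. (-1) * f x) \<in> schwartz" by (intro schwartz_cmult f)
  have G: "schwartz_bounded ?G"
    unfolding schwartz_bounded_def
  proof (intro conjI allI)
    fix N
    obtain B where B: "\<And>k x. jb x ^ N * jet N (F k) x \<le> B" using schwartz_boundedD(2)[OF F] by blast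
    obtain C where C: "\<And>x. jb x ^ N * jet N (\<lambda>x. (-1) * f x) x \<le> C"
      using schwartz_jet_bound[OF mf, of N N] by blast
    have "jb x ^ N * jet N (?G k) x \<le> B + C" for k x
    proof -
      have "jb x ^ N * jet N (?G k) x \<le> jb x ^ N * (jet N (F k) x + jet N (\<lambda>x. (-1) * f x) x)"
        using mf F by (intro mult_left_mono jet_add schwartz_smooth) (auto intro: schwartz_boundedD)
      then show ?thesis using B[of x k] C[of x] by (simp add: distrib_left)
    qed
    then show "\<exists>B. \<forall>k x. jb x ^ N * jet N (?G k) x \<le> B" by blast
  qed (intro schwartz_add mf schwartz_boundedD(1)[OF F])
  have null: "(\<lambda>k. ?G k x) \<longlonglongrightarrow> 0" for x
    using tendsto_add[OF lim[of x] tendsto_const[of "(-1) * f x"]] by simp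
  obtain N C where C: "0 \<le> C" and bound: "\<And>f B. f \<in> schwartz \<Longrightarrow> (\<And>x. jb x ^ N * jet N f x \<le> B) \<Longrightarrow> norm (u f) \<le> C * B"
    using temperate_bound[OF u] by blast
  have "(\<lambda>k. u (?G k)) \<longlonglongrightarrow> 0"
  proof (rule LIMSEQ_I)
    fix \<epsilon> :: real assume "0 < \<epsilon>"
    define \<delta> where "\<delta> = \<epsilon> / (C + 1)"
    have "0 < \<delta>" "C * \<delta> < \<epsilon>" using \<open>0 < \<epsilon>\<close> C by (auto simp: \<delta>_def field_simps)
    have "eventually (\<lambda>k. norm (u (?G k) - 0) < \<epsilon>) sequentially"
      using pointwise_null_jet_uniform[OF G null \<open>0 < \<delta>\<close>, of N N]
    proof eventually_elim
      case (elim k)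
      then have "norm (u (?G k)) \<le> C * \<delta>"
        by (intro bound schwartz_boundedD(1)[OF G]) auto
      then show ?case using \<open>C * \<delta> < \<epsilon>\<close> by simp
    qed
    then show "\<exists>no. \<forall>k\<ge>no. norm (u (?G k) - 0) < \<epsilon>" by (simp add: eventually_sequentially)
  qed
  moreover have "u (?G k) = u (F k) - u f" for k
    using temperate_add[OF u schwartz_boundedD(1)[OF F] mf] temperate_cmult[OF u f, of "-1"] by simp
  ultimately show ?thesis by (simp add: LIM_zero_iff)
qed

section \<open>The short-time Fourier transform of a temperate distribution\<close>

text \<open>The conjugate of M_xi T_x f is M_(-xi) T_x applied to the conjugate of f. Since
  \<open>bracket\<close> conjugates its test function, \<open>stft\<close> evaluates
  \<open>u\<close> at such flipped shifts.\<close>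

definition freq_flip :: "(real^'n) \<times> (real^'n) \<Rightarrow> (real^'n) \<times> (real^'n)" where
  "freq_flip z = (fst z, - snd z)"

lemma jb_freq_flip [simp]: "jb (freq_flip z) = jb z"
  by (simp add: freq_flip_def japanese_bracket_def norm_prod_def)

lemma cnj_tf_shift: "cnj (tf_shift z f y) = tf_shift (freq_flip z) (\<lambda>x. cnj (f x)) y"
  by (simp add: tf_shift_eq freq_flip_def cnj_character)

lemma stft_eq: "stft \<phi> u z = u (tf_shift (freq_flip z) (\<lambda>x. cnj (\<phi> x)))"
  by (simp add: stft_def bracket_def cnj_tf_shift)

lemma schwartz_continuous: "f \<in> schwartz \<Longrightarrow> continuous_on S f"
  by (meson continuous_at_imp_continuous_on differentiable_imp_continuous_within schwartz_smooth smooth_differentiable)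

lemma continuous_on_tf_shift:
  assumes "f \<in> schwartz" "continuous_on S w"
  shows "continuous_on S (\<lambda>x. tf_shift (w x) f y)"
  unfolding tf_shift_eq using assms(2)
  by (intro continuous_intros continuous_on_compose2[OF schwartz_continuous[OF assms(1), of UNIV]]) auto

text \<open>Seminorms of a shift by w grow polynomially in \<open>jb w\<close>, so bounds on all
  moments of the coefficients suffice. The points \<open>w k v\<close> are kept apart from the
  indices \<open>v\<close> to allow sums translated by a fixed \<open>z\<close> and one-term
  sums.\<close>

lemma schwartz_bounded_tf_shift_sum:
  assumes "f \<in> schwartz" "\<And>L. \<exists>A. \<forall>k. (\<Sum>v\<in>I k. norm (a k v) * jb (w k v) ^ L) \<le> A"
  shows "schwartz_bounded (\<lambda>k x. \<Sum>v\<in>I k. a k v * tf_shift (w k v) f x)"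
  unfolding schwartz_bounded_def
proof (intro conjI allI)
  fix N
  obtain B where B: "0 \<le> B" "\<And>x z. jb x ^ N * jet N (tf_shift z f) x \<le> B * jb z ^ (2 * N)"
    using jet_tf_shift_bound[OF assms(1), of N] by blast
  obtain A where A: "\<And>k. (\<Sum>v\<in>I k. norm (a k v) * jb (w k v) ^ (2 * N)) \<le> A"
    using assms(2) by blast
  have "jb x ^ N * jet N (\<lambda>x. \<Sum>v\<in>I k. a k v * tf_shift (w k v) f x) x \<le> B * A" for k x
  proof -
    have "jet N (\<lambda>x. \<Sum>v\<in>I k. a k v * tf_shift (w k v) f x) x \<le>
        (\<Sum>v\<in>I k. norm (a k v) * jet N (tf_shift (w k v) f) x)"
      by (rule order_trans[OF jet_sum])
        (auto intro!: sum_mono jet_cmult schwartz_cmult schwartz_tf_shift schwartz_smooth assms)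
    then have "jb x ^ N * jet N (\<lambda>x. \<Sum>v\<in>I k. a k v * tf_shift (w k v) f x) x \<le>
        jb x ^ N * (\<Sum>v\<in>I k. norm (a k v) * jet N (tf_shift (w k v) f) x)"
      by (intro mult_left_mono) auto
    also have "\<dots> = (\<Sum>v\<in>I k. norm (a k v) * (jb x ^ N * jet N (tf_shift (w k v) f) x))"
      by (simp add: sum_distrib_left mult_ac)
    also have "\<dots> \<le> (\<Sum>v\<in>I k. norm (a k v) * (B * jb (w k v) ^ (2 * N)))"
      by (intro sum_mono mult_left_mono B) auto
    also have "\<dots> = B * (\<Sum>v\<in>I k. norm (a k v) * jb (w k v) ^ (2 * N))"
      by (simp add: sum_distrib_left mult_ac)
    also have "\<dots> \<le> B * A" by (intro mult_left_mono A B)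
    finally show ?thesis .
  qed
  then show "\<exists>B. \<forall>k x. jb x ^ N * jet N (\<lambda>x. \<Sum>v\<in>I k. a k v * tf_shift (w k v) f x) x \<le> B" by blast
qed (auto intro!: schwartz_sum schwartz_cmult schwartz_tf_shift assms)

lemma stft_growth:
  assumes "temperate_distribution u" "\<phi> \<in> schwartz"
  shows "\<exists>N C. 0 \<le> C \<and> (\<forall>z. norm (stft \<phi> u z) \<le> C * jb z ^ N)"
proof -
  obtain N C where C: "0 \<le> C" and bound: "\<And>f B. f \<in> schwartz \<Longrightarrow> (\<And>x. jb x ^ N * jet N f x \<le> B) \<Longrightarrow> norm (u f) \<le> C * B"
    using temperate_bound[OF assms(1)] by blast
  obtain B where B: "0 \<le> B" "\<And>x z. jb x ^ N * jet N (tf_shift z (\<lambda>x. cnj (\<phi> x))) x \<le> B * jb z ^ (2 * N)"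
    using jet_tf_shift_bound[OF schwartz_cnj[OF assms(2)], of N] by blast
  have "norm (stft \<phi> u z) \<le> (C * B) * jb z ^ (2 * N)" for z
    unfolding stft_eq mult.assoc
    by (intro bound schwartz_tf_shift schwartz_cnj assms) (metis B(2) jb_freq_flip)
  then show ?thesis using C B(1) by (intro exI[of _ "2 * N"] exI[of _ "C * B"]) auto
qed

lemma continuous_on_stft:
  fixes u :: "(real^'n \<Rightarrow> complex) \<Rightarrow> complex"
  assumes "temperate_distribution u" "\<phi> \<in> schwartz"
  shows "continuous_on UNIV (stft \<phi> u)"
proof (rule continuous_on_sequentiallyI)
  fix z :: "nat \<Rightarrow> (real^'n) \<times> (real^'n)" and a assume lim: "z \<longlonglongrightarrow> a"
  let ?f = "\<lambda>x. cnj (\<phi> x)"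
  \<comment> \<open>A one-term sum over \<open>{()}\<close>, so that the criterion for sums also
    covers a convergent sequence of shifts.\<close>
  let ?F = "\<lambda>k x. \<Sum>v\<in>{()}. 1 * tf_shift (freq_flip (z k)) ?f x"
  have f: "?f \<in> schwartz" by (intro schwartz_cnj assms)
  obtain K where K: "\<And>k. norm (z k) \<le> K"
    using convergent_imp_Bseq[of z] lim unfolding convergent_def Bseq_def by blast
  have "jb (z k) \<le> 1 + K" for k
    using jb_le_1_norm[of "z k"] K[of k] by linarith
  then have "schwartz_bounded ?F"
    by (intro schwartz_bounded_tf_shift_sum f) (auto intro!: exI[of _ "(1 + K) ^ _"] power_mono)
  moreover have "(\<lambda>k. ?F k x) \<longlonglongrightarrow> tf_shift (freq_flip a) ?f x" for x
  proof -
    have "continuous_on UNIV (\<lambda>z. tf_shift (freq_flip z) ?f x)"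
      by (intro continuous_on_tf_shift f) (auto simp: freq_flip_def intro!: continuous_intros)
    from continuous_on_tendsto_compose[OF this lim] show ?thesis by simp
  qed
  ultimately have "(\<lambda>k. u (?F k)) \<longlonglongrightarrow> u (tf_shift (freq_flip a) ?f)"
    by (intro temperate_tendsto[OF assms(1)] schwartz_tf_shift f)
  then show "(\<lambda>k. stft \<phi> u (z k)) \<longlonglongrightarrow> stft \<phi> u a"
    by (simp add: stft_eq)
qed

text \<open>Time-frequency shifts compose up to a unimodular phase, which disappears in all later
  absolute values.\<close>

lemma tf_shift_tf_shift:
  "tf_shift z (tf_shift w f) y = character (snd w) (- fst z) * tf_shift (z + w) f y"
proof -
  have "character (snd w) (y - fst z) = character (snd w) y * character (snd w) (- fst z)"
    using character_add2[of "snd w" y "- fst z"] by simp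
  then show ?thesis by (simp add: tf_shift_eq character_add algebra_simps)
qed

text \<open>Shifting the approximating sums by \<open>z\<close> gives combinations of shifts of
  \<open>\<phi>\<close> at the points \<open>z + v\<close>, on which \<open>u\<close> acts termwise.
  A sequence with a bound on each member serves a pointwise supremum as well as Fatou's
  lemma.\<close>

lemma stft_approximation:
  assumes u: "temperate_distribution u" and \<phi>: "\<phi> \<in> schwartz" and \<psi>: "\<psi> \<in> schwartz"
    and weight: "\<And>L. \<exists>A. \<forall>k. (\<Sum>v\<in>I k. norm (a k v) * jb v ^ L) \<le> A"
    and lim: "\<And>x. (\<lambda>k. \<Sum>v\<in>I k. a k v * tf_shift v \<phi> x) \<longlonglongrightarrow> \<psi> x"
  shows "\<exists>S. S \<longlonglongrightarrow> stft \<psi> u z \<and> (\<forall>k. norm (S k) \<le> (\<Sum>v\<in>I k. norm (a k v) * norm (stft \<phi> u (z + v))))"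
proof -
  let ?f = "\<lambda>x. cnj (\<phi> x)" and ?g = "\<lambda>x. cnj (\<psi> x)"
  have f: "?f \<in> schwartz" and g: "?g \<in> schwartz" using \<phi> \<psi> by (auto intro: schwartz_cnj)
  \<comment> \<open>The conjugate stems from \<open>bracket\<close>, the character from composing
    the shifts by \<open>z\<close> and \<open>v\<close>.\<close>
  let ?b = "\<lambda>k v. cnj (a k v * character (snd v) (- fst z))"
  let ?F = "\<lambda>k x. \<Sum>v\<in>I k. ?b k v * tf_shift (freq_flip (z + v)) ?f x"
  have "schwartz_bounded ?F"
  proof (rule schwartz_bounded_tf_shift_sum[OF f])
    fix L
    obtain A where A: "\<And>k. (\<Sum>v\<in>I k. norm (a k v) * jb v ^ L) \<le> A" using weight by blast
    have "(\<Sum>v\<in>I k. norm (?b k v) * jb (freq_flip (z + v)) ^ L) \<le> (2 * jb z) ^ L * A" for k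
    proof -
      have "(\<Sum>v\<in>I k. norm (?b k v) * jb (freq_flip (z + v)) ^ L) \<le> (\<Sum>v\<in>I k. norm (a k v) * (2 * jb z * jb v) ^ L)"
        by (intro sum_mono mult_mono) (auto intro!: power_mono jb_peetre simp: norm_mult)
      also have "\<dots> = (2 * jb z) ^ L * (\<Sum>v\<in>I k. norm (a k v) * jb v ^ L)"
        by (simp add: sum_distrib_left power_mult_distrib mult_ac)
      also have "\<dots> \<le> (2 * jb z) ^ L * A" by (intro mult_left_mono A) auto
      finally show ?thesis .
    qed
    then show "\<exists>A. \<forall>k. (\<Sum>v\<in>I k. norm (?b k v) * jb (freq_flip (z + v)) ^ L) \<le> A" by blast
  qed
  moreover have "(\<lambda>k. ?F k x) \<longlonglongrightarrow> tf_shift (freq_flip z) ?g x" for x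
  proof -
    have "?F k x = cnj (tf_shift z (\<lambda>x. \<Sum>v\<in>I k. a k v * tf_shift v \<phi> x) x)" for k
    proof -
      have "tf_shift z (\<lambda>x. \<Sum>v\<in>I k. a k v * tf_shift v \<phi> x) x = (\<Sum>v\<in>I k. a k v * tf_shift z (tf_shift v \<phi>) x)"
        by (simp add: tf_shift_eq[of z] sum_distrib_right mult.assoc)
      then show ?thesis
        by (simp add: tf_shift_tf_shift cnj_tf_shift[symmetric] mult_ac)
    qed
    moreover have "(\<lambda>k. cnj (tf_shift z (\<lambda>x. \<Sum>v\<in>I k. a k v * tf_shift v \<phi> x) x)) \<longlonglongrightarrow> cnj (tf_shift z \<psi> x)"
      unfolding tf_shift_eq[of z] by (intro tendsto_cnj tendsto_mult tendsto_const lim)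
    ultimately show ?thesis by (simp add: cnj_tf_shift)
  qed
  ultimately have "(\<lambda>k. u (?F k)) \<longlonglongrightarrow> stft \<psi> u z"
    unfolding stft_eq by (intro temperate_tendsto[OF u] schwartz_tf_shift g)
  moreover have "u (?F k) = (\<Sum>v\<in>I k. ?b k v * stft \<phi> u (z + v))" for k
    unfolding stft_eq by (intro temperate_sum[OF u] schwartz_tf_shift f)
  moreover have "norm (\<Sum>v\<in>I k. ?b k v * stft \<phi> u (z + v)) \<le> (\<Sum>v\<in>I k. norm (a k v) * norm (stft \<phi> u (z + v)))" for k
    by (rule order_trans[OF norm_sum]) (simp add: norm_mult)
  ultimately show ?thesis by (intro exI[of _ "\<lambda>k. u (?F k)"]) auto
qed


section \<open>Integration over Euclidean spaces\<close>

lemma lborel_integral_translation_scale: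
  fixes f :: "'a::euclidean_space \<Rightarrow> 'b::{banach, second_countable_topology}"
  assumes "c \<noteq> 0" and [measurable]: "f \<in> borel_measurable borel"
  shows "(LINT x|lborel. f x) = \<bar>c\<bar> ^ DIM('a) *\<^sub>R (LINT x|lborel. f (t + c *\<^sub>R x))"
  by (subst lborel_affine[OF assms(1), of t])
    (simp add: integral_density integral_distr)

lemma lborel_integral_translation:
  fixes f :: "'a::euclidean_space \<Rightarrow> 'b::{banach, second_countable_topology}"
  assumes "f \<in> borel_measurable borel"
  shows "(LINT x|lborel. f (x + t)) = (LINT x|lborel. f x)"
  using lborel_integral_translation_scale[OF _ assms, of 1 t] by (simp add: add.commute)

lemma
  fixes f :: "'a::euclidean_space \<Rightarrow> real \<Rightarrow> 'b::{real_normed_field, banach, second_countable_topology}"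
  assumes "\<And>b. b \<in> Basis \<Longrightarrow> integrable lborel (f b)"
  shows lborel_integrable_prod_Basis: "integrable lborel (\<lambda>x. \<Prod>b\<in>Basis. f b (x \<bullet> b))"
    and lborel_integral_prod_Basis: "(LINT x|lborel. (\<Prod>b\<in>Basis. f b (x \<bullet> b))) = (\<Prod>b\<in>Basis. (LINT x|lborel. f b x))"
proof -
  interpret product_sigma_finite "\<lambda>_::'a. lborel :: real measure" by standard
  have [measurable]: "f b \<in> borel_measurable borel" if "b \<in> Basis" for b
    using borel_measurable_integrable[OF assms[OF that]] by simp
  have [measurable]: "(\<lambda>x. \<Prod>b\<in>Basis. f b (x \<bullet> b)) \<in> borel_measurable borel"
    by (intro borel_measurable_prod) measurable
  have *: "(\<Prod>b\<in>Basis. f b ((\<Sum>b\<in>Basis. g b *\<^sub>R b) \<bullet> b)) = (\<Prod>b\<in>Basis. f b (g b))" for g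
    by (intro prod.cong) simp_all
  show "integrable lborel (\<lambda>x. \<Prod>b\<in>Basis. f b (x \<bullet> b))"
    by (subst lborel_eq, subst integrable_distr_eq) (auto simp: * intro!: product_integrable_prod assms)
  show "(LINT x|lborel. (\<Prod>b\<in>Basis. f b (x \<bullet> b))) = (\<Prod>b\<in>Basis. (LINT x|lborel. f b x))"
    by (subst lborel_eq, subst integral_distr) (auto simp: * intro!: product_integral_prod assms)
qed

text \<open>Each of the \<open>DIM('a)\<close> factors 1 + x_b^2 is at most the squared bracket, so
  a product of integrable functions of one variable dominates. This is the origin of the exponent
  \<open>2 * DIM('a)\<close> in the later bounds.\<close>

lemma integrable_jb_power:
  "integrable lborel (\<lambda>x::'a::euclidean_space. 1 / jb x ^ (2 * DIM('a)))"
proof (rule Bochner_Integration.integrable_bound)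
  have "integrable lborel (\<lambda>x::real. inverse (1 + x\<^sup>2))"
    using integrable_inverse_1_plus_square by (simp add: set_integrable_def)
  then show "integrable lborel (\<lambda>x::'a. \<Prod>b\<in>Basis. inverse (1 + (x \<bullet> b)\<^sup>2))"
    by (intro lborel_integrable_prod_Basis)
  have "1 / jb x ^ (2 * DIM('a)) \<le> (\<Prod>b\<in>Basis. inverse (1 + (x \<bullet> b)\<^sup>2))" for x :: 'a
  proof -
    have "(\<Prod>b\<in>Basis. 1 + (x \<bullet> b)\<^sup>2) \<le> (\<Prod>b\<in>(Basis::'a set). (jb x)\<^sup>2)"
    proof (rule prod_mono)
      fix b :: 'a assume "b \<in> Basis"
      then have "(x \<bullet> b)\<^sup>2 \<le> (norm x)\<^sup>2" using Basis_le_norm[of b x] by (metis abs_le_square_iff abs_norm_cancel)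
      then show "0 \<le> 1 + (x \<bullet> b)\<^sup>2 \<and> 1 + (x \<bullet> b)\<^sup>2 \<le> (jb x)\<^sup>2" by (simp add: jb_sq)
    qed
    also have "\<dots> = jb x ^ (2 * DIM('a))" by (simp add: power_mult)
    finally have "inverse (jb x ^ (2 * DIM('a))) \<le> inverse (\<Prod>b\<in>Basis. 1 + (x \<bullet> b)\<^sup>2)"
      by (intro le_imp_inverse_le prod_pos) (auto intro: add_pos_nonneg)
    then show ?thesis by (simp add: inverse_eq_divide prod_dividef)
  qed
  then show "AE x::'a in lborel. norm (1 / jb x ^ (2 * DIM('a))) \<le> norm (\<Prod>b\<in>Basis. inverse (1 + (x \<bullet> b)\<^sup>2))"
    by (intro AE_I2) (auto intro: order_trans[OF _ abs_ge_self])
qed simp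

lemma integrable_jb_powerI:
  fixes f :: "'a::euclidean_space \<Rightarrow> 'b::{banach, second_countable_topology}"
  assumes "f \<in> borel_measurable borel" "\<And>x. jb x ^ (2 * DIM('a)) * norm (f x) \<le> B"
  shows "integrable lborel f"
proof (rule Bochner_Integration.integrable_bound)
  show "integrable lborel (\<lambda>x::'a. B * (1 / jb x ^ (2 * DIM('a))))"
    by (intro integrable_mult_right integrable_jb_power)
  have "norm (f x) \<le> B * (1 / jb x ^ (2 * DIM('a)))" for x
    using assms(2)[of x] by (simp add: field_simps)
  then show "AE x in lborel. norm (f x) \<le> norm (B * (1 / jb x ^ (2 * DIM('a))))"
    by (intro AE_I2) (metis abs_ge_self order_trans real_norm_def)
qed (use assms in simp)

lemma integral_jb_power_le:
  fixes f :: "'a::euclidean_space \<Rightarrow> real"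
  assumes "f \<in> borel_measurable borel" "\<And>x. 0 \<le> f x" "\<And>x. jb x ^ (2 * DIM('a)) * f x \<le> B"
  shows "(LINT x|lborel. f x) \<le> B * (LINT x|lborel. 1 / jb (x::'a) ^ (2 * DIM('a)))"
proof -
  have "(LINT x|lborel. f x) \<le> (LINT x|lborel. B * (1 / jb (x::'a) ^ (2 * DIM('a))))"
  proof (rule integral_mono)
    show "integrable lborel f" using assms by (intro integrable_jb_powerI[of f B]) auto
    show "f x \<le> B * (1 / jb x ^ (2 * DIM('a)))" for x
      using assms(3)[of x] by (simp add: field_simps)
  qed (intro integrable_mult_right integrable_jb_power)
  then show ?thesis by (simp only: integral_mult_right_zero)
qed

lemma integrable_product_bound:
  fixes F :: "'a::euclidean_space \<times> 'b::euclidean_space \<Rightarrow> 'c::{banach, second_countable_topology}"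
  assumes [measurable]: "F \<in> borel_measurable (lborel \<Otimes>\<^sub>M lborel)"
    and g: "integrable lborel g" and h: "integrable lborel h"
    and bound: "\<And>x y. norm (F (x, y)) \<le> g x * h y"
  shows "integrable (lborel \<Otimes>\<^sub>M lborel) F"
proof (rule lborel_pair.Fubini_integrable)
  have int2: "integrable lborel (\<lambda>y. F (x, y))" for x
    by (intro Bochner_Integration.integrable_bound[OF integrable_mult_right[OF h, of "g x"]])
      (auto intro!: AE_I2 order_trans[OF bound])
  then show "AE x in lborel. integrable lborel (\<lambda>y. F (x, y))" by simp
  show "integrable lborel (\<lambda>x. LINT y|lborel. norm (F (x, y)))"
  proof (rule Bochner_Integration.integrable_bound)
    show "integrable lborel (\<lambda>x. g x * (LINT y|lborel. h y))" by (intro integrable_mult_left g)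
    have "(LINT y|lborel. norm (F (x, y))) \<le> g x * (LINT y|lborel. h y)" for x
      unfolding integral_mult_right_zero[symmetric]
      by (intro integral_mono integrable_norm int2 integrable_mult_right h bound)
    then show "AE x in lborel. norm (LINT y|lborel. norm (F (x, y))) \<le> norm (g x * (LINT y|lborel. h y))"
      by (auto intro!: AE_I2 intro: order_trans[OF _ abs_ge_self])
  qed measurable
qed measurable

text \<open>The exceptional set is open and null, hence empty. This upgrades almost-everywhere
  statements about continuous functions, in particular bounds by essential suprema, to pointwise
  ones.\<close>

lemma AE_open_imp_all:
  fixes S :: "'a::euclidean_space set"
  assumes "AE x in lborel. x \<in> S \<longrightarrow> P x" "open {x \<in> S. \<not> P x}" "x \<in> S"
  shows "P x"
proof (rule ccontr)
  assume "\<not> P x"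
  then have "{x \<in> S. \<not> P x} \<noteq> {}" using assms(3) by blast
  then have "\<not> negligible {x \<in> S. \<not> P x}" by (intro open_not_negligible assms(2))
  moreover have "{x \<in> S. \<not> P x} \<in> null_sets lborel"
    using assms(1,2) by (subst AE_iff_null_sets) auto
  ultimately show False
    by (simp add: negligible_iff_null_sets null_sets_completionI)
qed

section \<open>The Fourier transform\<close>

text \<open>Normalised so that its Fourier transform can be read off from the characteristic
  function of the standard normal distribution; the 2 pi in \<open>character\<close> then reappears
  as a dilation.\<close>

definition gaussian :: "'a::euclidean_space \<Rightarrow> real" where
  "gaussian x = exp (- (norm x)\<^sup>2 / 2)"

lemma gaussian_bounds: "0 \<le> gaussian x" "gaussian x \<le> 1"
  by (simp_all add: gaussian_def)

lemma continuous_on_gaussian [continuous_intros]: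
  "continuous_on S f \<Longrightarrow> continuous_on S (\<lambda>x. gaussian (f x))"
  unfolding gaussian_def by (intro continuous_intros) auto

lemma borel_measurable_gaussian [measurable]: "gaussian \<in> borel_measurable borel"
  by (intro borel_measurable_continuous_onI continuous_intros)

lemma gaussian_prod: "gaussian x = (\<Prod>b\<in>Basis. exp (- (x \<bullet> b)\<^sup>2 / 2))"
  by (simp add: gaussian_def exp_sum[symmetric] sum_negf sum_divide_distrib[symmetric] euclidean_inner[of x x]
      power2_norm_eq_inner) (simp add: power2_eq_square)

lemma borel_measurable_cis [measurable]: "cis \<in> borel_measurable borel"
  unfolding cis_conv_exp[abs_def] by measurable

lemma integral_gaussian_1:
  shows "integrable lborel (\<lambda>x. complex_of_real (exp (- x\<^sup>2 / 2)) * cis (t * x))"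
    and "(LINT x|lborel. complex_of_real (exp (- x\<^sup>2 / 2)) * cis (t * x)) = complex_of_real (sqrt (2 * pi) * exp (- t\<^sup>2 / 2))"
proof -
  have *: "complex_of_real (exp (- x\<^sup>2 / 2)) = complex_of_real (sqrt (2 * pi)) * complex_of_real (std_normal_density x)" for x
    by (simp add: std_normal_density_def)
  have "integrable lborel (\<lambda>x. complex_of_real (std_normal_density x))"
    using integrable_std_normal_moment[of 0] by (auto intro: integrable_of_real)
  then have "integrable lborel (\<lambda>x. complex_of_real (std_normal_density x) * cis (t * x))"
    by (rule Bochner_Integration.integrable_bound) (auto simp: norm_mult)
  then show "integrable lborel (\<lambda>x. complex_of_real (exp (- x\<^sup>2 / 2)) * cis (t * x))"
    unfolding * mult.assoc by (rule integrable_mult_right)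
  have "(LINT x|lborel. complex_of_real (std_normal_density x) * cis (t * x)) = char std_normal_distribution t"
    unfolding char_def by (subst integral_density) (auto simp: cis_conv_exp scaleR_conv_of_real)
  also have "\<dots> = complex_of_real (exp (- t\<^sup>2 / 2))" by (simp add: char_std_normal_distribution)
  finally have "(LINT x|lborel. complex_of_real (std_normal_density x) * cis (t * x)) = complex_of_real (exp (- t\<^sup>2 / 2))" .
  then show "(LINT x|lborel. complex_of_real (exp (- x\<^sup>2 / 2)) * cis (t * x)) = complex_of_real (sqrt (2 * pi) * exp (- t\<^sup>2 / 2))"
    by (subst *) (simp only: mult.assoc integral_mult_right_zero of_real_mult)
qed

lemma cis_sum: "finite A \<Longrightarrow> cis (\<Sum>a\<in>A. f a) = (\<Prod>a\<in>A. cis (f a))"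
  by (induction A rule: finite_induct) (auto simp: cis_mult[symmetric])

lemma fourier_gaussian:
  fixes a :: "'a::euclidean_space"
  shows "integrable lborel (\<lambda>x. complex_of_real (gaussian x) * cis (a \<bullet> x))"
    and "(LINT x|lborel. complex_of_real (gaussian x) * cis (a \<bullet> x)) = complex_of_real (sqrt (2 * pi) ^ DIM('a) * gaussian a)"
proof -
  let ?f = "\<lambda>b s. complex_of_real (exp (- s\<^sup>2 / 2)) * cis ((a \<bullet> b) * s)"
  have *: "complex_of_real (gaussian x) * cis (a \<bullet> x) = (\<Prod>b\<in>Basis. ?f b (x \<bullet> b))" for x
    by (subst euclidean_inner) (simp add: gaussian_prod prod.distrib cis_sum)
  show "integrable lborel (\<lambda>x. complex_of_real (gaussian x) * cis (a \<bullet> x))"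
    unfolding * by (intro lborel_integrable_prod_Basis integral_gaussian_1)
  have "(LINT x|lborel. complex_of_real (gaussian x) * cis (a \<bullet> x)) = (\<Prod>b\<in>(Basis::'a set). complex_of_real (sqrt (2 * pi) * exp (- (a \<bullet> b)\<^sup>2 / 2)))"
    unfolding * by (subst lborel_integral_prod_Basis) (simp_all only: integral_gaussian_1)
  also have "\<dots> = complex_of_real (sqrt (2 * pi) ^ DIM('a) * gaussian a)"
    by (simp add: prod.distrib gaussian_prod)
  finally show "(LINT x|lborel. complex_of_real (gaussian x) * cis (a \<bullet> x)) = complex_of_real (sqrt (2 * pi) ^ DIM('a) * gaussian a)" .
qed

lemma integrable_gaussian: "integrable lborel (gaussian :: 'a::euclidean_space \<Rightarrow> real)"
  using integrable_norm[OF fourier_gaussian(1)[of "0::'a"]] by (simp add: gaussian_bounds)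

lemma integral_gaussian: "(LINT x|lborel. gaussian (x::'a::euclidean_space)) = sqrt (2 * pi) ^ DIM('a)"
proof -
  have "complex_of_real (LINT x|lborel. gaussian (x::'a)) = complex_of_real (sqrt (2 * pi) ^ DIM('a))"
    using fourier_gaussian(2)[of "0::'a"] by (simp add: gaussian_def)
  then show ?thesis by (simp only: of_real_eq_iff)
qed

definition fourier :: "(real^'n \<Rightarrow> complex) \<Rightarrow> real^'n \<Rightarrow> complex" where
  "fourier f \<xi> = (LINT y|lborel. f y * character (- \<xi>) y)"

lemma borel_measurable_character [measurable (raw)]:
  "f \<in> borel_measurable M \<Longrightarrow> g \<in> borel_measurable M \<Longrightarrow> (\<lambda>x. character (f x) (g x)) \<in> borel_measurable M"
  unfolding character_def by measurable

text \<open>Damping the inversion integral by a Gaussian turns it into a Gaussian average of \<open>f\<close>.\<close>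

lemma fourier_gaussian_mean:
  fixes f :: "real^'n \<Rightarrow> complex"
  assumes f: "integrable lborel f" and "0 < \<epsilon>"
  shows "(LINT \<xi>|lborel. gaussian (\<epsilon> *\<^sub>R \<xi>) * (fourier f \<xi> * character \<xi> y)) =
    (LINT s|lborel. f (y + (\<epsilon> / (2 * pi)) *\<^sub>R s) * gaussian s) / complex_of_real (sqrt (2 * pi) ^ CARD('n))"
proof -
  have [measurable]: "f \<in> borel_measurable borel" using borel_measurable_integrable[OF f] by simp
  let ?c = "sqrt (2 * pi) ^ CARD('n)"
  let ?g = "\<lambda>t \<xi>. f t * (gaussian (\<epsilon> *\<^sub>R \<xi>) * character \<xi> (y - t))"
  have char: "character (- \<xi>) t * character \<xi> y = character \<xi> (y - t)" for \<xi> t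
    by (simp add: character_cis cis_mult algebra_simps)
  have int_g: "integrable lborel (\<lambda>\<xi>::real^'n. gaussian (\<epsilon> *\<^sub>R \<xi>))"
    using integrable_gaussian[where 'a="real^'n"] \<open>0 < \<epsilon>\<close>
    by (subst (asm) lborel_affine[of \<epsilon> 0]) (auto simp: integrable_density integrable_distr_eq)
  have "(LINT \<xi>|lborel. gaussian (\<epsilon> *\<^sub>R \<xi>) * (fourier f \<xi> * character \<xi> y)) = (LINT \<xi>|lborel. LINT t|lborel. ?g t \<xi>)"
    unfolding fourier_def by (simp add: char[symmetric] mult_ac integral_mult_right_zero[symmetric] integral_mult_left_zero[symmetric] del: integral_mult_right_zero integral_mult_left_zero)
  also have "\<dots> = (LINT t|lborel. LINT \<xi>|lborel. ?g t \<xi>)"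
  proof (rule lborel_pair.Fubini_integral, rule integrable_product_bound)
    show "(\<lambda>(t, \<xi>). ?g t \<xi>) \<in> borel_measurable (lborel \<Otimes>\<^sub>M lborel)" by measurable
    show "integrable lborel (\<lambda>t. norm (f t))" by (intro integrable_norm f)
  qed (use int_g in \<open>auto simp: norm_mult gaussian_bounds\<close>)
  \<comment> \<open>The inner integral is the Fourier transform of a dilated Gaussian: the dilation
    contributes the power of \<epsilon>, and \<open>character\<close> produces the argument
    \<open>(2 * pi / \<epsilon>) *\<^sub>R (y - t)\<close>.\<close>
  also have "\<dots> = (LINT t|lborel. f t * complex_of_real (?c / \<epsilon> ^ CARD('n) * gaussian ((2 * pi / \<epsilon>) *\<^sub>R (y - t))))"
  proof (rule Bochner_Integration.integral_cong[OF refl])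
    fix t
    have "(LINT \<xi>|lborel. gaussian (\<epsilon> *\<^sub>R \<xi>) * character \<xi> (y - t)) =
      (1 / \<epsilon>) ^ CARD('n) *\<^sub>R (LINT \<xi>|lborel. gaussian \<xi> * cis (((2 * pi / \<epsilon>) *\<^sub>R (y - t)) \<bullet> \<xi>))"
      using \<open>0 < \<epsilon>\<close> by (subst lborel_integral_translation_scale[of "1 / \<epsilon>" _ 0])
        (auto simp: character_cis inner_commute)
    also have "\<dots> = ?c / \<epsilon> ^ CARD('n) * gaussian ((2 * pi / \<epsilon>) *\<^sub>R (y - t))"
      by (subst fourier_gaussian(2)) (simp add: scaleR_conv_of_real power_divide)
    finally show "(LINT \<xi>|lborel. ?g t \<xi>) = f t * complex_of_real (?c / \<epsilon> ^ CARD('n) * gaussian ((2 * pi / \<epsilon>) *\<^sub>R (y - t)))"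
      by simp
  qed
  \<comment> \<open>Substituting t = y + (\<epsilon> / 2 pi) s frees the Gaussian of \<epsilon>;
    being even, it ignores the sign of \<open>s\<close>.\<close>
  also have "\<dots> = (\<epsilon> / (2 * pi)) ^ CARD('n) *\<^sub>R (LINT s|lborel. f (y + (\<epsilon> / (2 * pi)) *\<^sub>R s) * complex_of_real (?c / \<epsilon> ^ CARD('n) * gaussian s))"
    using \<open>0 < \<epsilon>\<close> by (subst lborel_integral_translation_scale[of "\<epsilon> / (2 * pi)" _ y])
      (auto simp: gaussian_def)
  also have "(LINT s|lborel. f (y + (\<epsilon> / (2 * pi)) *\<^sub>R s) * complex_of_real (?c / \<epsilon> ^ CARD('n) * gaussian s)) =
      (LINT s|lborel. (f (y + (\<epsilon> / (2 * pi)) *\<^sub>R s) * gaussian s) * complex_of_real (?c / \<epsilon> ^ CARD('n)))"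
    by (simp add: mult_ac)
  also have "\<dots> = (LINT s|lborel. f (y + (\<epsilon> / (2 * pi)) *\<^sub>R s) * gaussian s) * complex_of_real (?c / \<epsilon> ^ CARD('n))"
    by (rule integral_mult_left_zero)
  also have "(\<epsilon> / (2 * pi)) ^ CARD('n) *\<^sub>R \<dots> = (LINT s|lborel. f (y + (\<epsilon> / (2 * pi)) *\<^sub>R s) * gaussian s) *
      complex_of_real ((\<epsilon> / (2 * pi)) ^ CARD('n) * (?c / \<epsilon> ^ CARD('n)))"
    by (simp add: scaleR_conv_of_real[where 'a=complex])
  \<comment> \<open>The powers of \<epsilon> cancel, and \<open>?c * ?c\<close> equals the remaining
    power of 2 pi.\<close>
  also have "(\<epsilon> / (2 * pi)) ^ CARD('n) * (?c / \<epsilon> ^ CARD('n)) = 1 / ?c"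
  proof -
    have "?c * ?c = (2 * pi) ^ CARD('n)"
      unfolding power_mult_distrib[symmetric] real_sqrt_mult_self by simp
    moreover have "a / (c * c) * (c / a) = 1 / c" if "a \<noteq> 0" for a c :: real using that by simp
    ultimately show ?thesis using \<open>0 < \<epsilon>\<close> unfolding power_divide by (metis power_eq_0_iff less_irrefl)
  qed
  finally show ?thesis by (simp only: of_real_divide of_real_1 times_divide_eq_right mult_1_right)
qed

text \<open>Both sides of the Gaussian mean formula converge as the damping disappears: the left one
  dominated by \<open>fourier f\<close>, the right one because the averages concentrate at
  \<open>y\<close>, dominated by a multiple of the Gaussian. The two limits agree.\<close>

lemma fourier_inversion:
  fixes f :: "real^'n \<Rightarrow> complex"
  assumes f: "integrable lborel f" "continuous_on UNIV f" "\<And>x. norm (f x) \<le> B"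
    and ff: "integrable lborel (fourier f)"
  shows "(LINT \<xi>|lborel. fourier f \<xi> * character \<xi> y) = f y"
proof -
  have [measurable]: "f \<in> borel_measurable borel" using borel_measurable_integrable[OF f(1)] by simp
  have [measurable]: "fourier f \<in> borel_measurable borel" using borel_measurable_integrable[OF ff] by simp
  define e where "e k = inverse (real (Suc k))" for k
  have e: "0 < e k" "e \<longlonglongrightarrow> 0" for k unfolding e_def by (simp, rule LIMSEQ_inverse_real_of_nat)
  let ?c = "sqrt (2 * pi) ^ CARD('n)"
  have L: "(\<lambda>k. LINT \<xi>|lborel. gaussian (e k *\<^sub>R \<xi>) * (fourier f \<xi> * character \<xi> y)) \<longlonglongrightarrow>
      (LINT \<xi>|lborel. fourier f \<xi> * character \<xi> y)"
  proof (rule integral_dominated_convergence[where w="\<lambda>\<xi>. norm (fourier f \<xi>)"])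
    have "(\<lambda>k. gaussian (e k *\<^sub>R \<xi>)) \<longlonglongrightarrow> gaussian (0 *\<^sub>R \<xi>)" for \<xi> :: "real^'n"
      unfolding gaussian_def by (intro tendsto_intros e) auto
    then have "(\<lambda>k. gaussian (e k *\<^sub>R \<xi>) * (fourier f \<xi> * character \<xi> y)) \<longlonglongrightarrow> complex_of_real 1 * (fourier f \<xi> * character \<xi> y)" for \<xi>
      by (intro tendsto_intros) (auto simp: gaussian_def)
    then show "AE \<xi> in lborel. (\<lambda>k. gaussian (e k *\<^sub>R \<xi>) * (fourier f \<xi> * character \<xi> y)) \<longlonglongrightarrow> fourier f \<xi> * character \<xi> y"
      by simp
    show "AE \<xi> in lborel. norm (gaussian (e k *\<^sub>R \<xi>) * (fourier f \<xi> * character \<xi> y)) \<le> norm (fourier f \<xi>)" for k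
      by (intro AE_I2) (simp add: norm_mult abs_of_nonneg[OF gaussian_bounds(1)] mult_left_le_one_le gaussian_bounds)
  qed (use ff in auto)
  have "(\<lambda>k. LINT s|lborel. f (y + (e k / (2 * pi)) *\<^sub>R s) * gaussian s) \<longlonglongrightarrow> (LINT s|lborel. f y * gaussian (s::real^'n))"
  proof (rule integral_dominated_convergence[where w="\<lambda>s. B * gaussian s"])
    show "AE s in lborel. (\<lambda>k. f (y + (e k / (2 * pi)) *\<^sub>R s) * gaussian s) \<longlonglongrightarrow> f y * gaussian s"
    proof (rule AE_I2)
      fix s :: "real^'n"
      have "(\<lambda>k. y + (e k / (2 * pi)) *\<^sub>R s) \<longlonglongrightarrow> y + (0 / (2 * pi)) *\<^sub>R s"
        by (intro tendsto_intros e) simp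
      then have "(\<lambda>k. f (y + (e k / (2 * pi)) *\<^sub>R s)) \<longlonglongrightarrow> f y"
        by (intro continuous_on_tendsto_compose[OF f(2)]) auto
      then show "(\<lambda>k. f (y + (e k / (2 * pi)) *\<^sub>R s) * gaussian s) \<longlonglongrightarrow> f y * gaussian s"
        by (intro tendsto_intros)
    qed
    show "AE s in lborel. norm (f (y + (e k / (2 * pi)) *\<^sub>R s) * gaussian s) \<le> B * gaussian s" for k
      using f(3) by (intro AE_I2) (simp add: norm_mult abs_of_nonneg[OF gaussian_bounds(1)] mult_right_mono gaussian_bounds)
  qed (auto intro: integrable_gaussian)
  also have "(LINT s|lborel. f y * gaussian (s::real^'n)) = f y * complex_of_real ?c"
    by (simp add: integral_gaussian)
  finally have "(\<lambda>k. (LINT s|lborel. f (y + (e k / (2 * pi)) *\<^sub>R s) * gaussian s) / complex_of_real ?c) \<longlonglongrightarrow> f y * complex_of_real ?c / complex_of_real ?c"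
    by (intro tendsto_divide tendsto_const) auto
  then have "(\<lambda>k. LINT \<xi>|lborel. gaussian (e k *\<^sub>R \<xi>) * (fourier f \<xi> * character \<xi> y)) \<longlonglongrightarrow> f y"
    unfolding fourier_gaussian_mean[OF f(1) e(1)] by simp
  from LIMSEQ_unique[OF L this] show ?thesis .
qed


section \<open>Decay of Fourier transforms\<close>

lemma continuous_on_jet: "smooth f \<Longrightarrow> continuous_on S (jet N f)"
proof (induction N arbitrary: f)
  case 0
  have "continuous_on S f"
    by (meson 0 continuous_at_imp_continuous_on differentiable_imp_continuous_within smooth_differentiable)
  then show ?case unfolding jet.simps by (intro continuous_intros)
next
  case (Suc N)
  then show ?case unfolding jet.simps by (intro continuous_intros) (auto intro: smooth_partial_deriv)
qed

lemma borel_measurable_schwartz: "f \<in> schwartz \<Longrightarrow> f \<in> borel_measurable borel"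
  by (intro borel_measurable_continuous_onI schwartz_continuous)

lemma borel_measurable_jet: "f \<in> schwartz \<Longrightarrow> jet N f \<in> borel_measurable borel"
  by (intro borel_measurable_continuous_onI continuous_on_jet schwartz_smooth)

lemma integrable_jet:
  fixes f :: "real^'n \<Rightarrow> complex"
  assumes "f \<in> schwartz"
  shows "integrable lborel (jet N f)"
proof -
  obtain B where "\<And>x. jb x ^ (2 * CARD('n)) * jet N f x \<le> B"
    using schwartz_jet_bound[OF assms, of "2 * CARD('n)" N] by blast
  then show ?thesis by (intro integrable_jb_powerI[of _ B] borel_measurable_jet assms) simp
qed

lemma integrable_schwartz: "f \<in> schwartz \<Longrightarrow> integrable lborel f"
  using integrable_jet[of f 0]
  by (rule Bochner_Integration.integrable_bound) (auto intro: borel_measurable_schwartz)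

text \<open>The derivative is a limit of difference quotients, each of which integrates to 0 by
  translation invariance. A majorant common to all increments lets the limit pass through the
  integral.\<close>

lemma integral_partial_deriv_eq_0:
  fixes f :: "real^'n \<Rightarrow> complex"
  assumes f: "f \<in> schwartz"
  shows "(LINT y|lborel. partial_deriv i f y) = 0"
proof -
  let ?K = "2 * CARD('n)"
  note sf = schwartz_smooth[OF f]
  note [measurable] = borel_measurable_schwartz[OF f]
  have [measurable]: "partial_deriv i f \<in> borel_measurable borel"
    by (intro borel_measurable_schwartz schwartz_partial_deriv f)
  define e where "e k = inverse (real (Suc k))" for k
  have e: "0 < e k" "e k \<le> 1" "e \<longlonglongrightarrow> 0" for k unfolding e_def by (simp, simp add: inverse_le_1_iff, rule LIMSEQ_inverse_real_of_nat)
  define q where "q k y = (f (y + e k *\<^sub>R axis i 1) - f y) /\<^sub>R e k" for k y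
  obtain B where B: "\<And>x. jet 2 f x \<le> B" using schwartz_jet_bounded[OF f] by blast
  obtain A where A: "\<And>x. jb x ^ ?K * jet 1 f x \<le> A" using schwartz_jet_bound[OF f] by blast
  have lim: "(\<lambda>k. q k y) \<longlonglongrightarrow> partial_deriv i f y" for y
  proof (rule metric_tendsto_imp_tendsto[OF tendsto_mult_right_zero[OF e(3), of B]], intro always_eventually allI)
    fix k
    have "q k y - partial_deriv i f y = (f (y + e k *\<^sub>R axis i 1) - f y - e k *\<^sub>R partial_deriv i f y) /\<^sub>R e k"
      using e(1)[of k] by (simp add: q_def scaleR_diff_right)
    also have "norm \<dots> \<le> (B * e k * e k) / e k"
      using partial_deriv_remainder[OF sf B e(1)[of k], of y i] e(1)[of k]
      by (simp add: divide_inverse mult.commute mult_left_mono)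
    also have "\<dots> = B * e k" using e(1)[of k] by simp
    finally show "dist (q k y) (partial_deriv i f y) \<le> dist (B * e k) 0"
      by (simp add: dist_norm)
  qed
  \<comment> \<open>Increments are at most 1, so the bracket at \<open>y\<close> is at most 4 times
    the bracket at a point of the segment: one factor 2 is Peetre's, the other bounds the bracket of
    the short vector.\<close>
  have dom: "norm (q k y) \<le> A * 4 ^ ?K * (1 / jb y ^ ?K)" for k y
  proof -
    let ?D = "A * 4 ^ ?K * (1 / jb y ^ ?K)"
    have D: "norm (partial_deriv i f (y + s *\<^sub>R axis i 1)) \<le> ?D" if "s \<in> {0..e k}" for s
    proof -
      let ?y = "y + s *\<^sub>R axis i (1::real)"
      have "norm (- (s *\<^sub>R axis i (1::real))) \<le> 1" using that e(2)[of k] by simp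
      then have "jb (- (s *\<^sub>R axis i (1::real))) \<le> 2"
        using jb_le_1_norm[of "- (s *\<^sub>R axis i (1::real))"] by linarith
      from order_trans[OF jb_peetre[of ?y "- (s *\<^sub>R axis i (1::real))"] mult_left_mono[OF this]]
      have "jb y \<le> 4 * jb ?y" by simp
      then have "jb y ^ ?K \<le> (4 * jb ?y) ^ ?K" by (intro power_mono) auto
      then have "jb y ^ ?K * norm (partial_deriv i f ?y) \<le> (4 * jb ?y) ^ ?K * jet 1 f ?y"
        using jet_partial_deriv_le[of 0 i f ?y] by (intro mult_mono) auto
      also have "\<dots> = 4 ^ ?K * (jb ?y ^ ?K * jet 1 f ?y)" by (simp add: power_mult_distrib)
      also have "\<dots> \<le> 4 ^ ?K * A" by (intro mult_left_mono A) auto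
      finally show ?thesis by (simp add: field_simps)
    qed
    have "norm (f (y + e k *\<^sub>R axis i 1) - f (y + 0 *\<^sub>R axis i 1)) \<le> ?D * norm (e k - 0)"
    proof (rule differentiable_bound[of "{0..e k}" "\<lambda>s. f (y + s *\<^sub>R axis i 1)" "\<lambda>s r. r *\<^sub>R partial_deriv i f (y + s *\<^sub>R axis i 1)"])
      show "((\<lambda>s. f (y + s *\<^sub>R axis i 1)) has_derivative (\<lambda>r. r *\<^sub>R partial_deriv i f (y + s *\<^sub>R axis i 1))) (at s within {0..e k})" for s
        unfolding has_vector_derivative_def[symmetric] by (rule has_vector_derivative_partial_deriv[OF sf])
      show "onorm (\<lambda>r. r *\<^sub>R partial_deriv i f (y + s *\<^sub>R axis i 1)) \<le> ?D" if "s \<in> {0..e k}" for s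
      proof (rule onorm_bound)
        show "0 \<le> ?D" by (rule order_trans[OF norm_ge_zero D[OF that]])
        show "norm (r *\<^sub>R partial_deriv i f (y + s *\<^sub>R axis i 1)) \<le> ?D * norm r" for r
          using mult_left_mono[OF D[OF that], of "\<bar>r\<bar>"] by (simp only: norm_scaleR real_norm_def mult.commute abs_ge_zero)
      qed
    qed (use e(1)[of k] in auto)
    then have "norm (f (y + e k *\<^sub>R axis i 1) - f y) \<le> ?D * e k" using e(1)[of k] by simp
    then have "norm (f (y + e k *\<^sub>R axis i 1) - f y) / e k \<le> ?D"
      using e(1)[of k] by (subst pos_divide_le_eq)
    then show ?thesis using e(1)[of k] by (simp add: q_def divide_inverse mult.commute)
  qed
  have "(\<lambda>k. LINT y|lborel. q k y) \<longlonglongrightarrow> (LINT y|lborel. partial_deriv i f y)"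
  proof (rule integral_dominated_convergence[where w="\<lambda>y. A * 4 ^ ?K * (1 / jb y ^ ?K)"])
    show "integrable lborel (\<lambda>y::real^'n. A * 4 ^ ?K * (1 / jb y ^ ?K))"
      using integrable_jb_power[where 'a="real^'n"] by (intro integrable_mult_right) simp
    show "q k \<in> borel_measurable lborel" for k unfolding q_def[abs_def] by measurable
  qed (use lim dom in \<open>auto intro!: AE_I2 simp del: norm_scaleR\<close>)
  moreover have "(LINT y|lborel. q k y) = 0" for k
  proof -
    have "integrable lborel (\<lambda>y. f (y + e k *\<^sub>R axis i 1))"
      using integrable_schwartz[OF schwartz_translation[OF f, of "- (e k *\<^sub>R axis i 1)"]] by simp
    then show ?thesis unfolding q_def
      by (simp add: integrable_schwartz[OF f] lborel_integral_translation)
  qed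
  ultimately show ?thesis by (simp add: LIMSEQ_const_iff)
qed

lemma schwartz_mult_character: "f \<in> schwartz \<Longrightarrow> (\<lambda>y. f y * character \<xi> y) \<in> schwartz"
  by (intro schwartz_mult smooth_character) (auto intro: jet_character)

text \<open>Integration by parts: the derivative of \<open>f\<close> times the character is a
  derivative of a Schwartz function and so integrates to 0.\<close>

lemma fourier_partial_deriv:
  assumes f: "f \<in> schwartz"
  shows "fourier (partial_deriv i f) \<xi> = 2 * of_real pi * \<i> * of_real (\<xi> $ i) * fourier f \<xi>"
proof -
  let ?c = "2 * of_real pi * \<i> * complex_of_real (\<xi> $ i)"
  have "partial_deriv i (\<lambda>y. f y * character (- \<xi>) y) =
      (\<lambda>y. partial_deriv i f y * character (- \<xi>) y - ?c * (f y * character (- \<xi>) y))"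
    using f by (intro ext, subst partial_deriv_mult)
      (auto simp: partial_deriv_character algebra_simps intro!: smooth_differentiable schwartz_smooth smooth_character)
  with integral_partial_deriv_eq_0[OF schwartz_mult_character[OF f], of i "- \<xi>"]
  have "(LINT y|lborel. partial_deriv i f y * character (- \<xi>) y - ?c * (f y * character (- \<xi>) y)) = 0"
    by simp
  then show ?thesis unfolding fourier_def
    by (subst (asm) Bochner_Integration.integral_diff)
      (auto intro!: integrable_schwartz schwartz_cmult schwartz_mult_character schwartz_partial_deriv f)
qed

text \<open>Multiplying by the weight expands like the recursion of \<open>jet\<close>: the summand
  1 keeps \<open>f\<close>, and each \<open>2 * pi * \<bar>\<xi> $ i\<bar>\<close> turns the
  transform into that of a partial derivative. Hence no constant arises.\<close>

lemma fourier_decay: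
  assumes "f \<in> schwartz"
  shows "(1 + (\<Sum>i\<in>UNIV. 2 * pi * \<bar>\<xi> $ i\<bar>)) ^ N * norm (fourier f \<xi>) \<le> (LINT y|lborel. jet N f y)"
  using assms
proof (induction N arbitrary: f)
  case 0
  have "norm (fourier f \<xi>) \<le> (LINT y|lborel. norm (f y * character (- \<xi>) y))"
    unfolding fourier_def by (rule integral_norm_bound)
  then show ?case by (simp add: norm_mult)
next
  case (Suc N)
  let ?w = "(1 + (\<Sum>i\<in>UNIV. 2 * pi * \<bar>\<xi> $ i\<bar>)) ^ N"
  have "(1 + (\<Sum>i\<in>UNIV. 2 * pi * \<bar>\<xi> $ i\<bar>)) ^ Suc N * norm (fourier f \<xi>) =
     ?w * norm (fourier f \<xi>) + (\<Sum>i\<in>UNIV. ?w * norm (fourier (partial_deriv i f) \<xi>))"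
    by (simp add: fourier_partial_deriv[OF Suc.prems] norm_mult sum_distrib_left sum_distrib_right algebra_simps)
  also have "\<dots> \<le> (LINT y|lborel. jet N f y) + (\<Sum>i\<in>UNIV. LINT y|lborel. jet N (partial_deriv i f) y)"
    by (intro add_mono sum_mono Suc schwartz_partial_deriv)
  also have "\<dots> = (LINT y|lborel. jet (Suc N) f y)"
    unfolding jet.simps using Suc.prems
    by (subst Bochner_Integration.integral_add) (auto intro!: Bochner_Integration.integrable_sum Bochner_Integration.integral_sum[symmetric] integrable_jet schwartz_partial_deriv)
  finally show ?case .
qed

lemma jb_le_weight: "jb (\<xi>::real^'n) \<le> 1 + (\<Sum>i\<in>UNIV. 2 * pi * \<bar>\<xi> $ i\<bar>)"
proof -
  have "jb \<xi> \<le> 1 + (\<Sum>i\<in>UNIV. \<bar>\<xi> $ i\<bar>)"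
    using jb_le_1_norm[of \<xi>] norm_le_l1_cart[of \<xi>] by linarith
  also have "\<dots> \<le> 1 + (\<Sum>i\<in>UNIV. 2 * pi * \<bar>\<xi> $ i\<bar>)"
    using pi_ge_two by (intro add_left_mono sum_mono) (simp add: mult_le_cancel_right1)
  finally show ?thesis .
qed

lemma borel_measurable_cnj [measurable]: "cnj \<in> borel_measurable borel"
  by (intro borel_measurable_continuous_onI continuous_intros)

section \<open>Reconstruction from the short-time Fourier transform\<close>

definition windowed :: "(real^'n \<Rightarrow> complex) \<Rightarrow> (real^'n \<Rightarrow> complex) \<Rightarrow> real^'n \<Rightarrow> real^'n \<Rightarrow> complex" where
  "windowed \<phi> \<psi> x = (\<lambda>y. \<psi> y * cnj (\<phi> (y - x)))"

text \<open>V_phi psi for a function \<open>\<psi>\<close>, as a genuine integral. It supplies the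
  coefficients of the reconstruction, whereas \<open>stft\<close> is applied to functionals.\<close>

definition fun_stft :: "(real^'n \<Rightarrow> complex) \<Rightarrow> (real^'n \<Rightarrow> complex) \<Rightarrow> (real^'n) \<times> (real^'n) \<Rightarrow> complex" where
  "fun_stft \<phi> \<psi> w = fourier (windowed \<phi> \<psi> (fst w)) (snd w)"

lemma schwartz_windowed: "\<phi> \<in> schwartz \<Longrightarrow> \<psi> \<in> schwartz \<Longrightarrow> windowed \<phi> \<psi> x \<in> schwartz"
  unfolding windowed_def
  by (intro schwartz_mult schwartz_smooth schwartz_jet_bounded schwartz_cnj schwartz_translation)

text \<open>Decay in frequency comes from derivatives of the windowed function. Decay in position
  comes from x = y - (y - x): for large \<open>x\<close>, \<open>\<psi>\<close> or
  \<open>\<phi>\<close> is evaluated far out.\<close>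

lemma fun_stft_decay:
  fixes \<phi> \<psi> :: "real^'n \<Rightarrow> complex"
  assumes \<phi>: "\<phi> \<in> schwartz" and \<psi>: "\<psi> \<in> schwartz"
  shows "\<exists>C. \<forall>w. jb w ^ L * norm (fun_stft \<phi> \<psi> w) \<le> C"
proof -
  let ?K = "2 * DIM(real^'n)"
  let ?I = "LINT y|lborel. 1 / jb (y::real^'n) ^ ?K"
  \<comment> \<open>The power \<open>?K\<close> is reserved for integrating over \<open>y\<close>;
    the power \<open>L\<close> pays for Peetre's inequality.\<close>
  obtain A where A: "0 \<le> A" "\<And>y. jb y ^ (?K + L) * jet L \<psi> y \<le> A" using schwartz_jet_bound[OF \<psi>] by blast
  obtain B where B: "0 \<le> B" "\<And>y. jb y ^ L * jet L \<phi> y \<le> B" using schwartz_jet_bound[OF \<phi>] by blast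
  have "jb (x, \<xi>) ^ L * norm (fun_stft \<phi> \<psi> (x, \<xi>)) \<le> 2 ^ L * A * B * ?I" for x \<xi>
  proof -
    let ?f = "windowed \<phi> \<psi> x"
    have f: "?f \<in> schwartz" by (intro schwartz_windowed \<phi> \<psi>)
    have jet: "jb y ^ ?K * (jb x ^ L * jet L ?f y) \<le> 2 ^ L * A * B" for y
    proof -
      have "jet L (\<lambda>y. cnj (\<phi> (y - x))) y = jet L \<phi> (y - x)"
        by (simp add: jet_cnj[OF smooth_translation[OF schwartz_smooth[OF \<phi>]]] jet_translation[OF schwartz_smooth[OF \<phi>]])
      then have 1: "jet L ?f y \<le> jet L \<psi> y * jet L \<phi> (y - x)"
        unfolding windowed_def
        using jet_mult[OF schwartz_smooth[OF \<psi>] schwartz_smooth[OF schwartz_cnj[OF schwartz_translation[OF \<phi>, of x]]], of L y] by simp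
      have 2: "jb x ^ L \<le> (2 * jb y * jb (y - x)) ^ L"
        using jb_peetre[of y "- (y - x)"] unfolding jb_uminus by (intro power_mono) auto
      have "jb y ^ ?K * (jb x ^ L * jet L ?f y) \<le> jb y ^ ?K * ((2 * jb y * jb (y - x)) ^ L * (jet L \<psi> y * jet L \<phi> (y - x)))"
        by (intro mult_left_mono mult_mono 1 2) auto
      also have "\<dots> = 2 ^ L * (jb y ^ (?K + L) * jet L \<psi> y) * (jb (y - x) ^ L * jet L \<phi> (y - x))"
        unfolding power_mult_distrib power_add by (simp only: mult_ac)
      also have "\<dots> \<le> 2 ^ L * A * B"
        by (intro mult_mono mult_left_mono A B) (auto intro!: A mult_nonneg_nonneg)
      finally show ?thesis .
    qed
    have "jb (x, \<xi>) ^ L * norm (fun_stft \<phi> \<psi> (x, \<xi>)) \<le> (jb x * (1 + (\<Sum>i\<in>UNIV. 2 * pi * \<bar>\<xi> $ i\<bar>))) ^ L * norm (fourier ?f \<xi>)"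
      unfolding fun_stft_def fst_conv snd_conv
      by (intro mult_right_mono power_mono order_trans[OF jb_Pair] mult_left_mono jb_le_weight) auto
    also have "\<dots> = jb x ^ L * ((1 + (\<Sum>i\<in>UNIV. 2 * pi * \<bar>\<xi> $ i\<bar>)) ^ L * norm (fourier ?f \<xi>))"
      unfolding power_mult_distrib by (rule mult.assoc)
    also have "\<dots> \<le> jb x ^ L * (LINT y|lborel. jet L ?f y)"
      by (intro mult_left_mono fourier_decay f) auto
    also have "\<dots> = (LINT y|lborel. jb x ^ L * jet L ?f y)" by simp
    also have "\<dots> \<le> 2 ^ L * A * B * ?I"
      by (rule integral_jb_power_le) (auto intro!: jet borel_measurable_times borel_measurable_jet f simp del: DIM_cart)
    finally show ?thesis .
  qed
  then show ?thesis by (intro exI[of _ "2 ^ L * A * B * ?I"]) (simp add: split_paired_all)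
qed

lemma borel_measurable_fun_stft:
  fixes \<phi> \<psi> :: "real^'n \<Rightarrow> complex"
  assumes "\<phi> \<in> schwartz" "\<psi> \<in> schwartz"
  shows "fun_stft \<phi> \<psi> \<in> borel_measurable borel"
proof -
  note [measurable] = assms[THEN borel_measurable_schwartz]
  have [measurable]: "(fst :: (real^'n) \<times> (real^'n) \<Rightarrow> _) \<in> borel_measurable borel"
    "(snd :: (real^'n) \<times> (real^'n) \<Rightarrow> _) \<in> borel_measurable borel"
    by (intro borel_measurable_continuous_onI continuous_intros)+
  show ?thesis unfolding fun_stft_def[abs_def] fourier_def windowed_def by measurable
qed

lemma integrable_fun_stft:
  assumes "\<phi> \<in> schwartz" "\<psi> \<in> schwartz"
  shows "integrable lborel (\<lambda>w. jb w ^ L * norm (fun_stft \<phi> \<psi> w))"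
proof -
  note [measurable] = borel_measurable_fun_stft[OF assms]
  let ?K = "2 * DIM((real^'a) \<times> (real^'a))"
  obtain C where C: "\<And>w. jb w ^ (?K + L) * norm (fun_stft \<phi> \<psi> w) \<le> C" using fun_stft_decay[OF assms] by blast
  have "jb w ^ ?K * norm (jb w ^ L * norm (fun_stft \<phi> \<psi> w)) \<le> C" for w
    using C[of w] by (simp add: power_add mult.assoc abs_mult)
  then show ?thesis by (intro integrable_jb_powerI) auto
qed

text \<open>For fixed x, Fourier inversion in the frequency recovers the windowed function, and the
  window factor of the shift completes it to psi(y) |phi(y - x)|^2. Integrating over x leaves the
  squared norm of phi.\<close>

lemma fun_stft_reconstruction:
  fixes \<phi> \<psi> :: "real^'n \<Rightarrow> complex"
  assumes \<phi>: "\<phi> \<in> schwartz" and \<psi>: "\<psi> \<in> schwartz"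
  shows "(LINT w|lborel. fun_stft \<phi> \<psi> w * tf_shift w \<phi> y) = \<psi> y * complex_of_real (LINT x|lborel. (norm (\<phi> x))\<^sup>2)"
proof -
  note [measurable] = borel_measurable_schwartz[OF \<phi>] borel_measurable_schwartz[OF \<psi>] borel_measurable_fun_stft[OF \<phi> \<psi>]
  have [measurable]: "(\<lambda>w. tf_shift w \<phi> y) \<in> borel_measurable borel"
    by (intro borel_measurable_continuous_onI continuous_on_tf_shift \<phi> continuous_intros)
  obtain B where B: "\<And>x. norm (\<phi> x) \<le> B" using schwartz_jet_bounded[OF \<phi>, of 0] by auto
  have int: "integrable lborel (\<lambda>w. fun_stft \<phi> \<psi> w * tf_shift w \<phi> y)"
  proof (rule Bochner_Integration.integrable_bound)
    show "integrable lborel (\<lambda>w. B * (jb w ^ 0 * norm (fun_stft \<phi> \<psi> w)))"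
      by (intro integrable_mult_right integrable_fun_stft \<phi> \<psi>)
    have "norm (fun_stft \<phi> \<psi> w * tf_shift w \<phi> y) \<le> B * norm (fun_stft \<phi> \<psi> w)" for w
      using mult_right_mono[OF B, of "norm (fun_stft \<phi> \<psi> w)" "y - fst w"] by (simp add: norm_mult tf_shift_eq mult.commute)
    then show "AE w in lborel. norm (fun_stft \<phi> \<psi> w * tf_shift w \<phi> y) \<le> norm (B * (jb w ^ 0 * norm (fun_stft \<phi> \<psi> w)))"
      by (intro AE_I2) (auto intro: order_trans[OF _ abs_ge_self])
  qed measurable
  have inner: "(LINT \<xi>|lborel. fun_stft \<phi> \<psi> (x, \<xi>) * tf_shift (x, \<xi>) \<phi> y) = \<psi> y * complex_of_real ((norm (\<phi> (y - x)))\<^sup>2)" for x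
  proof -
    let ?f = "windowed \<phi> \<psi> x"
    have f: "?f \<in> schwartz" by (intro schwartz_windowed \<phi> \<psi>)
    obtain D where D: "\<And>y. norm (?f y) \<le> D" using schwartz_jet_bounded[OF f, of 0] by auto
    let ?K = "2 * DIM(real^'n)"
    obtain C where C: "\<And>w. jb w ^ ?K * norm (fun_stft \<phi> \<psi> w) \<le> C" using fun_stft_decay[OF \<phi> \<psi>] by blast
    have "jb \<xi> ^ ?K * norm (fourier ?f \<xi>) \<le> C" for \<xi>
      using order_trans[OF mult_right_mono[OF power_mono[OF jb_snd[of "(x, \<xi>)"]], of "norm (fourier ?f \<xi>)"] C[of "(x, \<xi>)", unfolded fun_stft_def fst_conv snd_conv]]
      by simp
    moreover have "fourier ?f \<in> borel_measurable borel"
      unfolding fourier_def[abs_def] windowed_def by measurable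
    ultimately have "integrable lborel (fourier ?f)"
      by (intro integrable_jb_powerI)
    then have "(LINT \<xi>|lborel. fourier ?f \<xi> * character \<xi> y) = ?f y"
      by (intro fourier_inversion[OF integrable_schwartz[OF f] schwartz_continuous[OF f] D])
    moreover have "(LINT \<xi>|lborel. fun_stft \<phi> \<psi> (x, \<xi>) * tf_shift (x, \<xi>) \<phi> y) = (LINT \<xi>|lborel. \<phi> (y - x) * (fourier ?f \<xi> * character \<xi> y))"
      by (simp add: fun_stft_def tf_shift_eq mult_ac)
    ultimately have "(LINT \<xi>|lborel. fun_stft \<phi> \<psi> (x, \<xi>) * tf_shift (x, \<xi>) \<phi> y) = \<phi> (y - x) * ?f y" by simp
    also have "\<dots> = \<psi> y * complex_of_real ((norm (\<phi> (y - x)))\<^sup>2)"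
      unfolding complex_norm_square windowed_def by (simp only: mult_ac)
    finally show ?thesis .
  qed
  have "(LINT w|lborel. fun_stft \<phi> \<psi> w * tf_shift w \<phi> y) = (LINT x|lborel. LINT \<xi>|lborel. fun_stft \<phi> \<psi> (x, \<xi>) * tf_shift (x, \<xi>) \<phi> y)"
    using lborel_pair.integral_fst'[of "\<lambda>w. fun_stft \<phi> \<psi> w * tf_shift w \<phi> y"] int by (simp add: lborel_prod)
  also have "\<dots> = \<psi> y * complex_of_real (LINT x|lborel. (norm (\<phi> (y - x)))\<^sup>2)"
    by (simp only: inner integral_mult_right_zero integral_complex_of_real)
  also have "(LINT x|lborel. (norm (\<phi> (y - x)))\<^sup>2) = (LINT x|lborel. (norm (\<phi> x))\<^sup>2)"
    by (subst (2) lborel_integral_translation_scale[of "-1" _ y]) auto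
  finally show ?thesis .
qed

text \<open>A vanishing integral would make \<open>\<phi>\<close> zero almost everywhere and, by
  continuity, everywhere. This permits division in the reconstruction formula.\<close>

lemma integral_norm_square_neq_0:
  assumes \<phi>: "\<phi> \<in> schwartz" "\<phi> \<noteq> (\<lambda>x. 0)"
  shows "(LINT x|lborel. (norm (\<phi> x))\<^sup>2) \<noteq> 0"
proof
  assume 0: "(LINT x|lborel. (norm (\<phi> x))\<^sup>2) = 0"
  have "(\<lambda>x. \<phi> x * cnj (\<phi> x)) \<in> schwartz"
    using schwartz_windowed[OF \<phi>(1) \<phi>(1), of 0] by (simp add: windowed_def)
  from integrable_norm[OF integrable_schwartz[OF this]]
  have "integrable lborel (\<lambda>x. (norm (\<phi> x))\<^sup>2)" by (simp add: norm_mult power2_eq_square)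
  then have "AE x in lborel. \<phi> x = 0"
    using 0 by (subst (asm) integral_nonneg_eq_0_iff_AE) auto
  moreover have "open {x. \<phi> x \<noteq> 0}"
    by (intro open_Collect_neq schwartz_continuous \<phi> continuous_on_const)
  ultimately have "\<phi> x = 0" for x
    using AE_open_imp_all[of UNIV "\<lambda>x. \<phi> x = 0" x] by simp
  then show False using \<phi>(2) by auto
qed

text \<open>On a level set of \<open>r\<close> the factor \<open>g (r w)\<close> is constant, so the
  finite sum is an integral in which \<open>r w\<close> replaces \<open>w\<close>. It is applied
  with a real \<open>g\<close> for the moments and a complex one for the sums of shifts.\<close>

lemma simple_function_integral_sum:
  fixes c g :: "_ \<Rightarrow> 'b::{real_normed_field, banach, second_countable_topology}"
  assumes r: "simple_function M r" and c: "integrable M c"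
  shows "(\<Sum>v\<in>r ` space M. (LINT w|M. indicator (r -` {v} \<inter> space M) w *\<^sub>R c w) * g v) = (LINT w|M. c w * g (r w))"
proof -
  have sets: "r -` {v} \<inter> space M \<in> sets M" for v by (rule simple_functionD(2)[OF r])
  have "(\<Sum>v\<in>r ` space M. (LINT w|M. indicator (r -` {v} \<inter> space M) w *\<^sub>R c w) * g v) =
      (\<Sum>v\<in>r ` space M. (LINT w|M. (indicator (r -` {v} \<inter> space M) w *\<^sub>R c w) * g v))"
    by (intro sum.cong refl integral_mult_left_zero[symmetric])
  also have "\<dots> = (LINT w|M. (\<Sum>v\<in>r ` space M. (indicator (r -` {v} \<inter> space M) w *\<^sub>R c w) * g v))"
    by (intro Bochner_Integration.integral_sum[symmetric] integrable_mult_left integrable_mult_indicator sets c)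
  also have "\<dots> = (LINT w|M. c w * g (r w))"
  proof (rule Bochner_Integration.integral_cong[OF refl])
    fix w assume w: "w \<in> space M"
    have "(\<Sum>v\<in>r ` space M. (indicator (r -` {v} \<inter> space M) w *\<^sub>R c w) * g v) =
       (\<Sum>v\<in>r ` space M. if v = r w then c w * g v else 0)"
      using w by (intro sum.cong) (auto simp: indicator_def)
    then show "(\<Sum>v\<in>r ` space M. (indicator (r -` {v} \<inter> space M) w *\<^sub>R c w) * g v) = c w * g (r w)"
      using w simple_functionD(1)[OF r] by (simp add: sum.delta)
  qed
  finally show ?thesis .
qed

lemma schwartz_approx_tf_shifts:
  fixes \<phi> \<psi> :: "real^'n \<Rightarrow> complex"
  assumes \<phi>: "\<phi> \<in> schwartz" "\<phi> \<noteq> (\<lambda>x. 0)" and \<psi>: "\<psi> \<in> schwartz"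
  shows "\<exists>I a. (\<forall>k::nat. finite (I k)) \<and> (\<forall>L. \<exists>A. \<forall>k. (\<Sum>v\<in>I k. norm (a k v) * jb v ^ L) \<le> A) \<and>
    (\<forall>x. (\<lambda>k. \<Sum>v\<in>I k. a k v * tf_shift v \<phi> x) \<longlonglongrightarrow> \<psi> x)"
proof -
  let ?Q = "complex_of_real (LINT x|lborel. (norm (\<phi> x))\<^sup>2)"
  have Q: "?Q \<noteq> 0" using integral_norm_square_neq_0[OF \<phi>] by simp
  define c where "c w = fun_stft \<phi> \<psi> w / ?Q" for w
  note [measurable] = borel_measurable_fun_stft[OF \<phi>(1) \<psi>]
  have [measurable]: "c \<in> borel_measurable borel" unfolding c_def[abs_def] by measurable
  have cint: "integrable lborel (\<lambda>w. norm (c w) * jb w ^ L)" for L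
    using integrable_divide_zero[OF integrable_fun_stft[OF \<phi>(1) \<psi>, of L], of "norm ?Q"]
    by (simp add: c_def norm_divide mult_ac)
  have c: "integrable lborel c"
    using cint[of 0] by (rule Bochner_Integration.integrable_bound) auto
  have rep: "(LINT w|lborel. c w * tf_shift w \<phi> y) = \<psi> y" for y
    using fun_stft_reconstruction[OF \<phi>(1) \<psi>, of y] Q by (simp add: c_def)
  \<comment> \<open>The base point 0 yields \<open>norm (r k w) \<le> 2 * norm w\<close>, so
    discretising increases a bracket at most by the factor 2.\<close>
  obtain r :: "nat \<Rightarrow> (real^'n) \<times> (real^'n) \<Rightarrow> (real^'n) \<times> (real^'n)" where
    r: "\<And>k. simple_function lborel (r k)" "\<And>w. (\<lambda>k. r k w) \<longlonglongrightarrow> w" "\<And>k w. norm (r k w) \<le> 2 * norm w"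
    using borel_measurable_implies_sequence_metric[of "\<lambda>w. w" "lborel :: ((real^'n) \<times> (real^'n)) measure" 0] by auto
  define I where "I k = r k ` space lborel" for k
  define a where "a k v = (LINT w|lborel. indicator (r k -` {v} \<inter> space lborel) w *\<^sub>R c w)" for k v
  have [measurable]: "r k \<in> borel_measurable borel" for k
    using borel_measurable_simple_function[OF r(1)[of k]] by simp
  show ?thesis
  proof (intro exI[of _ I] exI[of _ a] conjI allI)
    show "finite (I k)" for k unfolding I_def by (rule simple_functionD(1)[OF r(1)])
  next
    fix L
    have "(\<Sum>v\<in>I k. norm (a k v) * jb v ^ L) \<le> 2 ^ L * (LINT w|lborel. norm (c w) * jb w ^ L)" for k
    proof -
      have "(\<Sum>v\<in>I k. norm (a k v) * jb v ^ L) \<le>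
         (\<Sum>v\<in>I k. (LINT w|lborel. indicator (r k -` {v} \<inter> space lborel) w *\<^sub>R norm (c w)) * jb v ^ L)"
      proof (intro sum_mono mult_right_mono)
        fix v
        have "norm (a k v) \<le> (LINT w|lborel. norm (indicator (r k -` {v} \<inter> space lborel) w *\<^sub>R c w))"
          unfolding a_def by (rule integral_norm_bound)
        then show "norm (a k v) \<le> (LINT w|lborel. indicator (r k -` {v} \<inter> space lborel) w *\<^sub>R norm (c w))"
          by simp
      qed simp
      also have "\<dots> = (LINT w|lborel. norm (c w) * jb (r k w) ^ L)"
        unfolding I_def by (intro simple_function_integral_sum r integrable_norm c)
      also have "\<dots> \<le> (LINT w|lborel. 2 ^ L * (norm (c w) * jb w ^ L))"
      proof (rule integral_mono')
        show "integrable lborel (\<lambda>w. 2 ^ L * (norm (c w) * jb w ^ L))" by (intro integrable_mult_right cint)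
        fix w
        have "jb (r k w) ^ L \<le> (2 * jb w) ^ L" by (intro power_mono jb_scale_le r) auto
        then have "norm (c w) * jb (r k w) ^ L \<le> norm (c w) * (2 * jb w) ^ L" by (intro mult_left_mono) auto
        then show "norm (c w) * jb (r k w) ^ L \<le> 2 ^ L * (norm (c w) * jb w ^ L)"
          by (simp add: power_mult_distrib mult_ac)
      qed auto
      finally show ?thesis by simp
    qed
    then show "\<exists>A. \<forall>k. (\<Sum>v\<in>I k. norm (a k v) * jb v ^ L) \<le> A" by blast
  next
    fix y
    obtain B where B: "\<And>x. norm (\<phi> x) \<le> B" using schwartz_jet_bounded[OF \<phi>(1), of 0] by auto
    have cont: "continuous_on UNIV (\<lambda>w. tf_shift w \<phi> y)"
      by (intro continuous_on_tf_shift \<phi> continuous_intros)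
    then have [measurable]: "(\<lambda>w. tf_shift w \<phi> y) \<in> borel_measurable borel"
      by (rule borel_measurable_continuous_onI)
    have "(\<lambda>k. LINT w|lborel. c w * tf_shift (r k w) \<phi> y) \<longlonglongrightarrow> (LINT w|lborel. c w * tf_shift w \<phi> y)"
    proof (rule integral_dominated_convergence[where w="\<lambda>w. norm (c w) * B"])
      show "integrable lborel (\<lambda>w. norm (c w) * B)" by (intro integrable_mult_left integrable_norm c)
      show "AE w in lborel. (\<lambda>k. c w * tf_shift (r k w) \<phi> y) \<longlonglongrightarrow> c w * tf_shift w \<phi> y"
        by (intro AE_I2 tendsto_intros continuous_on_tendsto_compose[OF cont] r) auto
      show "AE w in lborel. norm (c w * tf_shift (r k w) \<phi> y) \<le> norm (c w) * B" for k
        using B by (intro AE_I2) (auto simp: norm_mult tf_shift_eq intro!: mult_left_mono)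
    qed auto
    moreover have "(\<Sum>v\<in>I k. a k v * tf_shift v \<phi> y) = (LINT w|lborel. c w * tf_shift (r k w) \<phi> y)" for k
      unfolding I_def a_def by (intro simple_function_integral_sum r c)
    ultimately show "(\<lambda>k. \<Sum>v\<in>I k. a k v * tf_shift v \<phi> y) \<longlonglongrightarrow> \<psi> y"
      by (simp add: rep)
  qed
qed


section \<open>The cone estimate\<close>

text \<open>Jensen's inequality for the weights divided by their total mass; restoring the mass
  leaves its power \<open>P - 1\<close>. The constant uses an upper bound \<open>A\<close> because
  the mass of the coefficients varies with the sum.\<close>

lemma powr_sum_le:
  fixes c t :: "'i \<Rightarrow> real"
  assumes "finite I" "\<And>i. i \<in> I \<Longrightarrow> 0 \<le> c i" "\<And>i. i \<in> I \<Longrightarrow> 0 \<le> t i" "(\<Sum>i\<in>I. c i) \<le> A" "1 \<le> P"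
  shows "(\<Sum>i\<in>I. c i * t i) powr P \<le> A powr (P - 1) * (\<Sum>i\<in>I. c i * t i powr P)"
proof -
  \<comment> \<open>Indices with \<open>t i = 0\<close> contribute 0 to both sides, as
    \<open>0 powr P\<close> is 0; the convexity of \<open>powr\<close> is then applied to positive
    arguments.\<close>
  let ?J = "{i \<in> I. 0 < t i}"
  let ?a = "\<Sum>i\<in>?J. c i"
  have fin: "finite ?J" using assms(1) by simp
  have eq: "(\<Sum>i\<in>I. c i * t i) = (\<Sum>i\<in>?J. c i * t i)"
    using assms by (intro sum.mono_neutral_right) (auto simp: less_le)
  have "0 \<le> ?a" using assms by (intro sum_nonneg) auto
  have "?a \<le> A"
    using assms by (intro order_trans[OF sum_mono2 assms(4)]) auto
  show ?thesis
  proof (cases "?a = 0")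
    case True
    then have "\<forall>i\<in>?J. c i = 0" using assms by (subst (asm) sum_nonneg_eq_0_iff[OF fin]) auto
    then show ?thesis unfolding eq
      using assms by (auto intro!: mult_nonneg_nonneg sum_nonneg)
  next
    case False
    then have a: "0 < ?a" using \<open>0 \<le> ?a\<close> by linarith
    then have "?J \<noteq> {}" by (metis less_irrefl sum.empty)
    have sum1: "(\<Sum>i\<in>?J. c i / ?a) = 1" using a by (simp add: sum_divide_distrib[symmetric])
    have "(\<Sum>i\<in>?J. (c i / ?a) *\<^sub>R t i) powr P \<le> (\<Sum>i\<in>?J. (c i / ?a) * t i powr P)"
      using assms a by (intro convex_on_sum[OF fin \<open>?J \<noteq> {}\<close> powr_convex[OF assms(5)] sum1]) auto
    then have "?a powr P * (\<Sum>i\<in>?J. (c i / ?a) * t i) powr P \<le> ?a powr P * (\<Sum>i\<in>?J. (c i / ?a) * t i powr P)"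
      by (intro mult_left_mono) auto
    moreover have "?a powr P * (\<Sum>i\<in>?J. (c i / ?a) * t i) powr P = (\<Sum>i\<in>?J. c i * t i) powr P"
    proof -
      have "?a powr P * (\<Sum>i\<in>?J. (c i / ?a) * t i) powr P = (?a * (\<Sum>i\<in>?J. (c i / ?a) * t i)) powr P"
        by (rule powr_mult[symmetric])
      also have "?a * (\<Sum>i\<in>?J. (c i / ?a) * t i) = (\<Sum>i\<in>?J. c i * t i)"
        unfolding sum_distrib_left using a by (intro sum.cong refl) simp
      finally show ?thesis .
    qed
    moreover have "?a powr P * (\<Sum>i\<in>?J. (c i / ?a) * t i powr P) = ?a powr (P - 1) * (\<Sum>i\<in>?J. c i * t i powr P)"
      using a by (simp add: powr_diff sum_divide_distrib[symmetric])
    ultimately have "(\<Sum>i\<in>I. c i * t i) powr P \<le> ?a powr (P - 1) * (\<Sum>i\<in>?J. c i * t i powr P)"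
      unfolding eq by simp
    also have "\<dots> \<le> A powr (P - 1) * (\<Sum>i\<in>I. c i * t i powr P)"
      using assms \<open>0 \<le> ?a\<close> \<open>?a \<le> A\<close>
      by (intro mult_mono powr_mono2 sum_mono2) (auto intro!: sum_nonneg)
    finally show ?thesis .
  qed
qed

text \<open>The closed spherical section is compact, so a uniform neighbourhood of it lies in
  \<open>\<Gamma>\<close>. Rescaling to the unit sphere turns its radius into a gap proportional to
  \<open>norm z\<close>.\<close>

lemma cone_separation:
  fixes \<Gamma> \<Gamma>' :: "'a::euclidean_space set"
  assumes \<Gamma>: "open \<Gamma>" "punctured_conic \<Gamma>" and \<Gamma>': "punctured_conic \<Gamma>'"
    and sub: "closure (\<Gamma>' \<inter> sphere 0 1) \<subseteq> \<Gamma>"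
  shows "\<exists>\<epsilon>>0. \<forall>z\<in>\<Gamma>'. \<forall>w. z + w \<notin> \<Gamma> \<longrightarrow> \<epsilon> * norm z \<le> norm w"
proof -
  have cpt: "compact (closure (\<Gamma>' \<inter> sphere 0 1))"
    by (simp add: compact_closure bounded_Int)
  obtain \<epsilon> where \<epsilon>: "0 < \<epsilon>" "(\<Union>x\<in>closure (\<Gamma>' \<inter> sphere 0 1). ball x \<epsilon>) \<subseteq> \<Gamma>"
    by (rule compact_subset_open_imp_ball_epsilon_subset[OF cpt \<Gamma>(1) sub])
  have "\<epsilon> * norm z \<le> norm w" if z: "z \<in> \<Gamma>'" and zw: "z + w \<notin> \<Gamma>" for z w
  proof (rule ccontr)
    assume "\<not> ?thesis"
    then have lt: "norm w < \<epsilon> * norm z" by simp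
    have "z \<noteq> 0" using z \<Gamma>' by (auto simp: punctured_conic_def)
    then have r: "0 < 1 / norm z" by simp
    let ?x = "(1 / norm z) *\<^sub>R z"
    have "?x \<in> \<Gamma>'"
      by (rule bspec[OF conjunct2[OF \<Gamma>'[unfolded punctured_conic_def]] z, rule_format, OF r])
    moreover have "?x \<in> sphere 0 1" using \<open>z \<noteq> 0\<close> by simp
    ultimately have "?x \<in> closure (\<Gamma>' \<inter> sphere 0 1)" by (intro subsetD[OF closure_subset] IntI)
    moreover have "(1 / norm z) *\<^sub>R (z + w) \<in> ball ?x \<epsilon>"
      using lt \<open>z \<noteq> 0\<close> by (simp add: dist_norm scaleR_add_right field_simps)
    ultimately have mem: "(1 / norm z) *\<^sub>R (z + w) \<in> \<Gamma>"
      by (intro subsetD[OF \<epsilon>(2)] UN_I)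
    have "norm z *\<^sub>R ((1 / norm z) *\<^sub>R (z + w)) \<in> \<Gamma>"
      by (rule bspec[OF conjunct2[OF \<Gamma>(2)[unfolded punctured_conic_def]] mem, rule_format]) (use \<open>z \<noteq> 0\<close> in simp)
    then show False using zw \<open>z \<noteq> 0\<close> by simp
  qed
  then show ?thesis using \<epsilon>(1) by (intro exI[of _ \<epsilon>] conjI ballI allI impI)
qed

text \<open>\<open>M\<close> is additional decay bought by powers of \<open>jb w\<close>: 0 is
  enough for a supremum, while an integral takes an integrable power.\<close>

lemma cone_shift_estimate:
  fixes V :: "'a::euclidean_space \<Rightarrow> complex"
  assumes \<Gamma>: "open \<Gamma>" "punctured_conic \<Gamma>" and \<Gamma>': "punctured_conic \<Gamma>'"
    and sub: "closure (\<Gamma>' \<inter> sphere 0 1) \<subseteq> \<Gamma>" and "0 \<le> s"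
    and growth: "0 \<le> C" "\<And>z. norm (V z) \<le> C * jb z ^ N"
  shows "\<exists>D\<ge>0. \<exists>L. \<forall>z\<in>\<Gamma>'. \<forall>w. norm (V (z + w)) * jb z powr s \<le> D * jb w ^ L *
      (if z + w \<in> \<Gamma> then norm (V (z + w)) * jb (z + w) powr s else 1 / jb z ^ M)"
proof -
  obtain \<epsilon> where \<epsilon>: "0 < \<epsilon>" "\<And>z w. z \<in> \<Gamma>' \<Longrightarrow> z + w \<notin> \<Gamma> \<Longrightarrow> \<epsilon> * norm z \<le> norm w"
    using cone_separation[OF \<Gamma> \<Gamma>' sub] by metis
  define S where "S = nat \<lceil>s\<rceil>"
  have S: "jb x powr s \<le> jb x ^ S" for x :: 'a
  proof -
    have "jb x powr s \<le> jb x powr (real S)" by (intro powr_mono) (auto simp: S_def real_nat_ceiling_ge)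
    then show ?thesis by (simp add: powr_realpow)
  qed
  \<comment> \<open>At least 1 as \<open>jb_scale_le\<close> demands, and at least
    \<open>1 / \<epsilon>\<close> as the angular gap demands.\<close>
  define d where "d = max 1 (1 / \<epsilon>)"
  have d: "1 \<le> d" "1 / \<epsilon> \<le> d" by (auto simp: d_def)
  \<comment> \<open>\<open>2 * N\<close> pays for the growth at \<open>z + w\<close>, whose bracket
    is bounded by a multiple of the square of \<open>jb w\<close>; \<open>S\<close> pays for the
    weight and \<open>M\<close> for the decay in \<open>z\<close>.\<close>
  define L where "L = 2 * N + S + M"
  define D where "D = 2 powr s + C * (2 * d) ^ N * d ^ (S + M)"
  have D: "0 \<le> D" "2 powr s \<le> D" "C * (2 * d) ^ N * d ^ (S + M) \<le> D"
    using growth(1) d(1) by (auto simp: D_def intro!: add_nonneg_nonneg mult_nonneg_nonneg)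
  have "norm (V (z + w)) * jb z powr s \<le> D * jb w ^ L *
      (if z + w \<in> \<Gamma> then norm (V (z + w)) * jb (z + w) powr s else 1 / jb z ^ M)" if z: "z \<in> \<Gamma>'" for z w
  proof (cases "z + w \<in> \<Gamma>")
    case True
    have "jb z powr s \<le> (2 * jb (z + w) * jb w) powr s"
      using jb_peetre[of "z + w" "- w"] \<open>0 \<le> s\<close> by (intro powr_mono2) auto
    also have "\<dots> = 2 powr s * jb w powr s * jb (z + w) powr s"
      by (simp add: powr_mult)
    also have "\<dots> \<le> D * jb w ^ L * jb (z + w) powr s"
    proof (intro mult_right_mono mult_mono D)
      show "jb w powr s \<le> jb w ^ L"
        using S[of w] power_increasing[of S L "jb w"] by (simp add: L_def)
    qed (auto simp: D)
    finally have "norm (V (z + w)) * jb z powr s \<le> norm (V (z + w)) * (D * jb w ^ L * jb (z + w) powr s)"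
      by (intro mult_left_mono) auto
    then show ?thesis using True by (simp add: mult_ac)
  next
    case False
    have "norm z \<le> (1 / \<epsilon>) * norm w"
      using \<epsilon>(2)[OF z False] \<epsilon>(1) by (simp add: field_simps)
    also have "\<dots> \<le> d * norm w" by (intro mult_right_mono d) auto
    finally have zd: "jb z \<le> d * jb w" by (intro jb_scale_le d)
    have "jb (z + w) \<le> 2 * jb z * jb w" by (rule jb_peetre)
    also have "\<dots> \<le> 2 * (d * jb w) * jb w" by (intro mult_right_mono mult_left_mono zd) auto
    finally have 1: "jb (z + w) \<le> 2 * d * (jb w * jb w)" by (simp add: mult_ac)
    have "norm (V (z + w)) * jb z powr s * jb z ^ M \<le> (C * (2 * d * (jb w * jb w)) ^ N) * (d * jb w) ^ S * (d * jb w) ^ M"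
      by (intro mult_mono order_trans[OF growth(2)] order_trans[OF S] power_mono mult_left_mono zd 1)
        (use growth(1) d in \<open>auto intro!: mult_nonneg_nonneg\<close>)
    also have "\<dots> = (C * (2 * d) ^ N * d ^ (S + M)) * jb w ^ L"
      unfolding L_def power_mult_distrib power_add mult_2 by (simp only: mult_ac)
    also have "\<dots> \<le> D * jb w ^ L" by (intro mult_right_mono D) auto
    finally have "norm (V (z + w)) * jb z powr s \<le> D * jb w ^ L / jb z ^ M"
      by (subst pos_le_divide_eq) auto
    then show ?thesis using False by simp
  qed
  then show ?thesis using D(1) by (intro exI[of _ D] exI[of _ L] conjI ballI allI)
qed

section \<open>Change of window in weighted spaces\<close>

lemma nn_integral_lborel_translation:
  fixes v :: "'a::euclidean_space"
  assumes [measurable]: "h \<in> borel_measurable borel"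
  shows "(\<integral>\<^sup>+ z. h (z + v) \<partial>lborel) = (\<integral>\<^sup>+ z. h z \<partial>lborel)"
  by (subst (2) lborel_distr_plus[of v, symmetric]) (simp add: nn_integral_distr add.commute)

text \<open>The part of the open set where the continuous function exceeds its essential supremum is
  open and null, hence empty. So the infinite exponent can be treated pointwise.\<close>

lemma weighted_Lp_on_infinity_iff:
  fixes F :: "'a::euclidean_space \<Rightarrow> complex"
  assumes F: "continuous_on UNIV F" and \<Gamma>: "open \<Gamma>"
  shows "weighted_Lp_on \<infinity> s \<Gamma> F \<longleftrightarrow> (\<exists>d\<ge>0. \<forall>z\<in>\<Gamma>. norm (F z) * jb z powr s \<le> d)"
proof
  let ?g = "\<lambda>z. norm (F z) * jb z powr s"
  have g: "continuous_on UNIV ?g"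
    by (intro continuous_intros F) (simp add: less_imp_neq[OF jb_pos, symmetric])
  let ?E = "esssup (restrict_space lborel \<Gamma>) (\<lambda>z. ennreal (?g z))"
  have restrict: "\<Gamma> \<inter> space lborel \<in> sets lborel" using \<Gamma> by simp
  show "\<exists>d\<ge>0. \<forall>z\<in>\<Gamma>. ?g z \<le> d" if "weighted_Lp_on \<infinity> s \<Gamma> F"
  proof (intro exI conjI ballI)
    have E: "?E < \<infinity>" using that by (simp add: weighted_Lp_on_def)
    have "AE z in restrict_space lborel \<Gamma>. ennreal (?g z) \<le> ?E" by (rule esssup_AE)
    then have "AE z in lborel. z \<in> \<Gamma> \<longrightarrow> ennreal (?g z) \<le> ?E"
      by (subst (asm) AE_restrict_space_iff[OF restrict])
    then have ae: "AE z in lborel. z \<in> \<Gamma> \<longrightarrow> ?g z \<le> enn2real ?E"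
    proof eventually_elim
      case (elim z)
      then show ?case using E by (cases ?E) auto
    qed
    have "{z \<in> \<Gamma>. \<not> ?g z \<le> enn2real ?E} = \<Gamma> \<inter> {z. enn2real ?E < ?g z}" by auto
    then have "open {z \<in> \<Gamma>. \<not> ?g z \<le> enn2real ?E}"
      using \<Gamma> g by (auto intro!: open_Int open_Collect_less continuous_on_const)
    then show "?g z \<le> enn2real ?E" if "z \<in> \<Gamma>" for z
      using AE_open_imp_all[OF ae] that by simp
  qed simp
  show "weighted_Lp_on \<infinity> s \<Gamma> F" if d: "\<exists>d\<ge>0. \<forall>z\<in>\<Gamma>. ?g z \<le> d"
  proof -
    obtain d where d: "\<And>z. z \<in> \<Gamma> \<Longrightarrow> ?g z \<le> d" using d by blast
    have [measurable]: "?g \<in> borel_measurable borel" using g by (rule borel_measurable_continuous_onI)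
    have "?E \<le> ennreal d"
    proof (rule esssup_I)
      show "(\<lambda>z. ennreal (?g z)) \<in> borel_measurable (restrict_space lborel \<Gamma>)"
        by (intro measurable_restrict_space1) measurable
      show "AE z in restrict_space lborel \<Gamma>. ennreal (?g z) \<le> ennreal d"
        using d by (intro AE_I2) (auto simp: space_restrict_space intro: ennreal_leI)
    qed
    then show ?thesis by (simp add: weighted_Lp_on_def order.strict_trans1)
  qed
qed

lemma stft_window_change_infinity:
  fixes u :: "(real^'n \<Rightarrow> complex) \<Rightarrow> complex"
  assumes u: "temperate_distribution u" and \<phi>: "\<phi> \<in> schwartz" "\<phi> \<noteq> (\<lambda>x. 0)" and \<psi>: "\<psi> \<in> schwartz" and "0 \<le> s"
    and \<Gamma>: "open \<Gamma>" "punctured_conic \<Gamma>" and \<Gamma>': "open \<Gamma>'" "punctured_conic \<Gamma>'"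
    and sub: "closure (\<Gamma>' \<inter> sphere 0 1) \<subseteq> \<Gamma>"
    and bound: "weighted_Lp_on \<infinity> s \<Gamma> (stft \<phi> u)"
  shows "weighted_Lp_on \<infinity> s \<Gamma>' (stft \<psi> u)"
proof -
  let ?V = "stft \<phi> u"
  obtain d where d: "0 \<le> d" "\<And>z. z \<in> \<Gamma> \<Longrightarrow> norm (?V z) * jb z powr s \<le> d"
    using bound weighted_Lp_on_infinity_iff[OF continuous_on_stft[OF u \<phi>(1)] \<Gamma>(1)] by blast
  obtain N C where C: "0 \<le> C" "\<And>z. norm (?V z) \<le> C * jb z ^ N" using stft_growth[OF u \<phi>(1)] by blast
  obtain D L where D0: "0 \<le> D" and DL: "\<forall>z\<in>\<Gamma>'. \<forall>w. norm (?V (z + w)) * jb z powr s \<le> D * jb w ^ L *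
      (if z + w \<in> \<Gamma> then norm (?V (z + w)) * jb (z + w) powr s else 1 / jb z ^ 0)"
    using cone_shift_estimate[OF \<Gamma> \<Gamma>'(2) sub \<open>0 \<le> s\<close> C, of 0] by (elim exE conjE) (rule that)
  note D = D0 DL[rule_format]
  obtain I :: "nat \<Rightarrow> _" and a :: "nat \<Rightarrow> _" where
    "\<forall>L. \<exists>A. \<forall>k. (\<Sum>v\<in>I k. norm (a k v) * jb v ^ L) \<le> A"
    and "\<forall>x. (\<lambda>k. \<Sum>v\<in>I k. a k v * tf_shift v \<phi> x) \<longlonglongrightarrow> \<psi> x"
    using schwartz_approx_tf_shifts[OF \<phi> \<psi>] by (elim exE conjE) (rule that)
  note weight = this(1)[rule_format] and lim = this(2)[rule_format]
  obtain A where A: "\<And>k. (\<Sum>v\<in>I k. norm (a k v) * jb v ^ L) \<le> A" using weight by blast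
  have "norm (stft \<psi> u z) * jb z powr s \<le> D * (d + 1) * A" if z: "z \<in> \<Gamma>'" for z
  proof -
    obtain S where S: "S \<longlonglongrightarrow> stft \<psi> u z" "\<And>k. norm (S k) \<le> (\<Sum>v\<in>I k. norm (a k v) * norm (?V (z + v)))"
      using stft_approximation[OF u \<phi>(1) \<psi> weight lim, of z] by blast
    have "norm (S k) * jb z powr s \<le> D * (d + 1) * A" for k
    proof -
      have "norm (S k) * jb z powr s \<le> (\<Sum>v\<in>I k. norm (a k v) * norm (?V (z + v))) * jb z powr s"
        by (intro mult_right_mono S) auto
      also have "\<dots> = (\<Sum>v\<in>I k. norm (a k v) * (norm (?V (z + v)) * jb z powr s))"
        unfolding sum_distrib_right by (simp only: mult.assoc)
      \<comment> \<open>\<open>d + 1\<close> covers both branches: the hypothesis gives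
        \<open>d\<close> inside the cone, and with decay power 0 the other branch equals 1.\<close>
      also have "\<dots> \<le> (\<Sum>v\<in>I k. norm (a k v) * (D * jb v ^ L * (d + 1)))"
      proof (intro sum_mono mult_left_mono)
        fix v
        have "D * jb v ^ L * (if z + v \<in> \<Gamma> then norm (?V (z + v)) * jb (z + v) powr s else 1 / jb z ^ 0) \<le> D * jb v ^ L * (d + 1)"
          using d(1) d(2)[of "z + v"] D(1) by (intro mult_left_mono) auto
        then show "norm (?V (z + v)) * jb z powr s \<le> D * jb v ^ L * (d + 1)"
          using D(2)[OF z, of v] by linarith
      qed simp
      also have "\<dots> = D * (d + 1) * (\<Sum>v\<in>I k. norm (a k v) * jb v ^ L)"
        unfolding sum_distrib_left by (intro sum.cong refl) (simp only: mult_ac)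
      also have "\<dots> \<le> D * (d + 1) * A" using D(1) d(1) by (intro mult_left_mono A) auto
      finally show ?thesis .
    qed
    moreover have "(\<lambda>k. norm (S k) * jb z powr s) \<longlonglongrightarrow> norm (stft \<psi> u z) * jb z powr s"
      by (intro tendsto_intros S)
    ultimately show ?thesis by (intro LIMSEQ_le_const2) auto
  qed
  moreover from this have "\<exists>d\<ge>0. \<forall>z\<in>\<Gamma>'. norm (stft \<psi> u z) * jb z powr s \<le> d"
    by (intro exI[of _ "max 0 (D * (d + 1) * A)"]) (auto intro: order_trans[OF _ max.cobounded2])
  ultimately show ?thesis
    using weighted_Lp_on_infinity_iff[OF continuous_on_stft[OF u \<psi>] \<Gamma>'(1)] by blast
qed

lemma stft_window_change_finite:
  fixes u :: "(real^'n \<Rightarrow> complex) \<Rightarrow> complex"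
  assumes u: "temperate_distribution u" and \<phi>: "\<phi> \<in> schwartz" "\<phi> \<noteq> (\<lambda>x. 0)" and \<psi>: "\<psi> \<in> schwartz" and "0 \<le> s"
    and \<Gamma>: "open \<Gamma>" "punctured_conic \<Gamma>" and \<Gamma>': "open \<Gamma>'" "punctured_conic \<Gamma>'"
    and sub: "closure (\<Gamma>' \<inter> sphere 0 1) \<subseteq> \<Gamma>" and P: "1 \<le> P"
    and bound: "(\<integral>\<^sup>+ z\<in>\<Gamma>. ennreal (norm (stft \<phi> u z) powr P * jb z powr (s * P)) \<partial>lborel) < \<infinity>"
  shows "(\<integral>\<^sup>+ z\<in>\<Gamma>'. ennreal (norm (stft \<psi> u z) powr P * jb z powr (s * P)) \<partial>lborel) < \<infinity>"
proof -
  let ?V = "stft \<phi> u"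
  let ?M = "2 * DIM((real^'n) \<times> (real^'n))"
  have [measurable]: "?V \<in> borel_measurable borel" "stft \<psi> u \<in> borel_measurable borel"
    using \<phi>(1) \<psi> by (auto intro!: borel_measurable_continuous_onI continuous_on_stft[OF u])
  have [measurable]: "\<Gamma> \<in> sets borel" "\<Gamma>' \<in> sets borel" using \<Gamma>(1) \<Gamma>'(1) by auto
  obtain N C where C: "0 \<le> C" "\<And>z. norm (?V z) \<le> C * jb z ^ N" using stft_growth[OF u \<phi>(1)] by blast
  obtain D L where D0: "0 \<le> D" and DL: "\<forall>z\<in>\<Gamma>'. \<forall>w. norm (?V (z + w)) * jb z powr s \<le> D * jb w ^ L *
      (if z + w \<in> \<Gamma> then norm (?V (z + w)) * jb (z + w) powr s else 1 / jb z ^ ?M)"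
    using cone_shift_estimate[OF \<Gamma> \<Gamma>'(2) sub \<open>0 \<le> s\<close> C, of ?M] by (elim exE conjE) (rule that)
  note D = D0 DL[rule_format]
  obtain I and a :: "nat \<Rightarrow> _" where "\<forall>k::nat. finite (I k)"
    and "\<forall>L. \<exists>A. \<forall>k. (\<Sum>v\<in>I k. norm (a k v) * jb v ^ L) \<le> A"
    and "\<forall>x. (\<lambda>k. \<Sum>v\<in>I k. a k v * tf_shift v \<phi> x) \<longlonglongrightarrow> \<psi> x"
    using schwartz_approx_tf_shifts[OF \<phi> \<psi>] by (elim exE conjE) (rule that)
  note fin = this(1)[rule_format] and weight = this(2)[rule_format] and lim = this(3)[rule_format]
  \<comment> \<open>The P-th power of \<open>jb v ^ L\<close> has a real exponent; \<open>L'\<close>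
    is a natural number above it, to which the moment bounds apply.\<close>
  define L' where "L' = nat \<lceil>real L * P\<rceil>"
  obtain A where A: "\<And>k. (\<Sum>v\<in>I k. norm (a k v)) \<le> A" using weight[of 0] by auto
  obtain A' where A': "\<And>k. (\<Sum>v\<in>I k. norm (a k v) * jb v ^ L') \<le> A'" using weight by blast
  \<comment> \<open>\<open>h\<close> carries the hypothesis, and \<open>j\<close> below is the
    integrable error of shifts that leave the cone. Their sum dominates whichever branch
    occurs.\<close>
  define h where "h z = ennreal (norm (?V z) powr P * jb z powr (s * P)) * indicator \<Gamma> z" for z
  have [measurable]: "h \<in> borel_measurable borel" unfolding h_def[abs_def] by measurable
  define j where "j z = ennreal (1 / jb z ^ ?M)" for z :: "(real^'n) \<times> (real^'n)"
  have [measurable]: "j \<in> borel_measurable borel" unfolding j_def[abs_def] by measurable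
  define T where "T k z = (\<Sum>v\<in>I k. norm (a k v) * norm (?V (z + v)))" for k z
  have [measurable]: "T k \<in> borel_measurable borel" for k unfolding T_def[abs_def] by measurable
  have T_nonneg: "0 \<le> T k z" for k z unfolding T_def by (auto intro!: sum_nonneg)
  \<comment> \<open>Jensen's inequality contributes the power of \<open>A\<close>, the cone estimate
    that of \<open>D\<close>.\<close>
  define B where "B = A powr (P - 1) * D powr P"
  have "0 \<le> B" by (simp add: B_def)
  have shift: "ennreal ((norm (?V (z + v)) * jb z powr s) powr P) \<le> ennreal (D powr P * jb v ^ L') * (h (z + v) + j z)"
    if z: "z \<in> \<Gamma>'" for z v
  proof -
    let ?q = "if z + v \<in> \<Gamma> then norm (?V (z + v)) * jb (z + v) powr s else 1 / jb z ^ ?M"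
    have "(norm (?V (z + v)) * jb z powr s) powr P \<le> (D * jb v ^ L * ?q) powr P"
      using D P z by (intro powr_mono2) auto
    also have "\<dots> = D powr P * (jb v ^ L) powr P * ?q powr P"
      using D(1) by (simp add: powr_mult)
    also have "\<dots> \<le> D powr P * jb v ^ L' * ?q powr P"
    proof (intro mult_right_mono mult_left_mono)
      have "(jb v ^ L) powr P = jb v powr (real L * P)" by (simp add: powr_powr powr_realpow[symmetric])
      also have "\<dots> \<le> jb v powr (real L')" by (intro powr_mono) (auto simp: L'_def real_nat_ceiling_ge)
      finally show "(jb v ^ L) powr P \<le> jb v ^ L'" by (simp add: powr_realpow)
    qed auto
    finally have "ennreal ((norm (?V (z + v)) * jb z powr s) powr P) \<le> ennreal (D powr P * jb v ^ L') * ennreal (?q powr P)"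
      by (simp add: ennreal_mult[symmetric] ennreal_leI)
    also have "\<dots> \<le> ennreal (D powr P * jb v ^ L') * (h (z + v) + j z)"
    proof (intro mult_left_mono)
      show "ennreal (?q powr P) \<le> h (z + v) + j z"
      proof (cases "z + v \<in> \<Gamma>")
        case True
        then show ?thesis by (simp add: h_def powr_mult powr_powr add_increasing2)
      next
        case False
        \<comment> \<open>The base is at most 1, so the exponent \<open>P\<close> only helps and
          \<open>?M\<close> can be chosen independently of it.\<close>
        have "(1 / jb z ^ ?M) powr P \<le> (1 / jb z ^ ?M) powr 1"
          using P by (intro powr_mono') (auto simp: one_le_power)
        then show ?thesis using False by (simp add: j_def h_def ennreal_leI)
      qed
    qed simp
    finally show ?thesis .
  qed
  have Tbound: "ennreal (T k z powr P * jb z powr (s * P)) * indicator \<Gamma>' z \<le>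
      (\<Sum>v\<in>I k. ennreal (B * (norm (a k v) * jb v ^ L')) * (h (z + v) + j z))" for k z
  proof (cases "z \<in> \<Gamma>'")
    case True
    have "T k z powr P * jb z powr (s * P) = (\<Sum>v\<in>I k. norm (a k v) * (norm (?V (z + v)) * jb z powr s)) powr P"
    proof -
      have "(\<Sum>v\<in>I k. norm (a k v) * (norm (?V (z + v)) * jb z powr s)) = T k z * jb z powr s"
        unfolding T_def sum_distrib_right by (simp only: mult.assoc)
      then show ?thesis using T_nonneg by (simp add: powr_mult powr_powr)
    qed
    also have "\<dots> \<le> A powr (P - 1) * (\<Sum>v\<in>I k. norm (a k v) * (norm (?V (z + v)) * jb z powr s) powr P)"
      by (intro powr_sum_le fin A P) auto
    finally have "ennreal (T k z powr P * jb z powr (s * P)) \<le>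
        (\<Sum>v\<in>I k. ennreal (A powr (P - 1) * norm (a k v)) * ennreal ((norm (?V (z + v)) * jb z powr s) powr P))"
      by (simp add: sum_distrib_left mult.assoc ennreal_leI sum_ennreal flip: ennreal_mult)
    also have "\<dots> \<le> (\<Sum>v\<in>I k. ennreal (A powr (P - 1) * norm (a k v)) * (ennreal (D powr P * jb v ^ L') * (h (z + v) + j z)))"
      by (intro sum_mono mult_left_mono shift True) simp
    also have "\<dots> = (\<Sum>v\<in>I k. ennreal (B * (norm (a k v) * jb v ^ L')) * (h (z + v) + j z))"
      by (intro sum.cong refl) (simp add: B_def mult.assoc[symmetric] flip: ennreal_mult, simp add: mult_ac)
    finally show ?thesis using True by simp
  qed simp
  \<comment> \<open>Translation invariance removes \<open>v\<close> from the integral of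
    \<open>h (z + v)\<close>; what remains is a coefficient moment, bounded by \<open>A'\<close>
    uniformly in \<open>k\<close>.\<close>
  define R where "R = ennreal (B * A') * ((\<integral>\<^sup>+ z. h z \<partial>lborel) + (\<integral>\<^sup>+ z. j z \<partial>lborel))"
  have "(\<integral>\<^sup>+ z. h z \<partial>lborel) < \<infinity>" using bound by (simp add: h_def)
  moreover have "(\<integral>\<^sup>+ z. j z \<partial>lborel) < \<infinity>"
    using integrable_jb_power[where 'a="(real^'n) \<times> (real^'n)"]
    unfolding j_def by (subst (asm) integrable_iff_bounded) simp
  ultimately have R: "R < \<infinity>" by (simp add: R_def ennreal_mult_less_top)
  have Tint: "(\<integral>\<^sup>+ z. ennreal (T k z powr P * jb z powr (s * P)) * indicator \<Gamma>' z \<partial>lborel) \<le> R" for k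
  proof -
    have "(\<integral>\<^sup>+ z. ennreal (T k z powr P * jb z powr (s * P)) * indicator \<Gamma>' z \<partial>lborel) \<le>
        (\<integral>\<^sup>+ z. (\<Sum>v\<in>I k. ennreal (B * (norm (a k v) * jb v ^ L')) * (h (z + v) + j z)) \<partial>lborel)"
      by (intro nn_integral_mono Tbound)
    also have "\<dots> = (\<Sum>v\<in>I k. ennreal (B * (norm (a k v) * jb v ^ L')) * ((\<integral>\<^sup>+ z. h z \<partial>lborel) + (\<integral>\<^sup>+ z. j z \<partial>lborel)))"
      by (simp add: nn_integral_sum nn_integral_cmult nn_integral_add nn_integral_lborel_translation)
    also have "\<dots> = ennreal (B * (\<Sum>v\<in>I k. norm (a k v) * jb v ^ L')) * ((\<integral>\<^sup>+ z. h z \<partial>lborel) + (\<integral>\<^sup>+ z. j z \<partial>lborel))"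
      using \<open>0 \<le> B\<close> by (subst sum_distrib_right[symmetric]) (simp add: sum_ennreal sum_distrib_left)
    also have "\<dots> \<le> R"
      unfolding R_def using \<open>0 \<le> B\<close> by (intro mult_right_mono ennreal_leI mult_left_mono A') auto
    finally show ?thesis .
  qed
  \<comment> \<open>The sequence \<open>S\<close> is chosen separately for each \<open>z\<close>,
    whereas the functions \<open>T k\<close> are global and measurable; Fatou's lemma is therefore
    applied to \<open>T k\<close>.\<close>
  have "ennreal (norm (stft \<psi> u z) powr P * jb z powr (s * P)) * indicator \<Gamma>' z \<le>
      liminf (\<lambda>k. ennreal (T k z powr P * jb z powr (s * P)) * indicator \<Gamma>' z)" for z
  proof (cases "z \<in> \<Gamma>'")
    case True
    obtain S where S: "S \<longlonglongrightarrow> stft \<psi> u z" "\<And>k. norm (S k) \<le> (\<Sum>v\<in>I k. norm (a k v) * norm (?V (z + v)))"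
      using stft_approximation[OF u \<phi>(1) \<psi> weight lim, of z] by blast
    \<comment> \<open>The limit may be 0; there \<open>powr\<close> is continuous from the
      nonnegative side because \<open>P\<close> is positive.\<close>
    have "(\<lambda>k. ennreal (norm (S k) powr P * jb z powr (s * P))) \<longlonglongrightarrow> ennreal (norm (stft \<psi> u z) powr P * jb z powr (s * P))"
      using P by (intro tendsto_ennrealI tendsto_mult tendsto_powr' tendsto_norm S tendsto_const) auto
    then have "ennreal (norm (stft \<psi> u z) powr P * jb z powr (s * P)) = liminf (\<lambda>k. ennreal (norm (S k) powr P * jb z powr (s * P)))"
      by (intro lim_imp_Liminf[symmetric]) auto
    also have "\<dots> \<le> liminf (\<lambda>k. ennreal (T k z powr P * jb z powr (s * P)))"
      using S(2) P by (intro Liminf_mono always_eventually allI ennreal_leI mult_right_mono powr_mono2) (auto simp: T_def)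
    finally show ?thesis using True by simp
  qed simp
  then have "(\<integral>\<^sup>+ z. ennreal (norm (stft \<psi> u z) powr P * jb z powr (s * P)) * indicator \<Gamma>' z \<partial>lborel) \<le>
      (\<integral>\<^sup>+ z. liminf (\<lambda>k. ennreal (T k z powr P * jb z powr (s * P)) * indicator \<Gamma>' z) \<partial>lborel)"
    by (intro nn_integral_mono)
  also have "\<dots> \<le> liminf (\<lambda>k. \<integral>\<^sup>+ z. ennreal (T k z powr P * jb z powr (s * P)) * indicator \<Gamma>' z \<partial>lborel)"
    by (intro nn_integral_liminf) measurable
  also have "\<dots> \<le> liminf (\<lambda>k::nat. R)"
    by (intro Liminf_mono always_eventually allI Tint)
  also have "\<dots> = R" by (simp add: Liminf_const)
  finally show ?thesis using R by (rule le_less_trans)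
qed

theorem proposition4:
  fixes p :: ennreal and s :: real
    and u :: "(real^'n \<Rightarrow> complex) \<Rightarrow> complex"
    and \<phi> \<psi> :: "real^'n \<Rightarrow> complex"
    and z0 :: "(real^'n) \<times> (real^'n)"
    and \<Gamma> \<Gamma>' :: "((real^'n) \<times> (real^'n)) set"
  assumes "1 \<le> p" and "0 \<le> s"
    and "temperate_distribution u"
    and "\<phi> \<in> schwartz" and "\<phi> \<noteq> (\<lambda>x. 0)"
    and "z0 \<noteq> 0"
    and "open_conic_nhd z0 \<Gamma>"
    and "weighted_Lp_on p s \<Gamma> (stft \<phi> u)"
    and "open_conic_nhd z0 \<Gamma>'"
    and "closure (\<Gamma>' \<inter> sphere 0 1) \<subseteq> \<Gamma>"
    and "\<psi> \<in> schwartz" and "\<psi> \<noteq> (\<lambda>x. 0)"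
  shows "weighted_Lp_on p s \<Gamma>' (stft \<psi> u)"
proof -
  have cones: "open \<Gamma>" "punctured_conic \<Gamma>" "open \<Gamma>'" "punctured_conic \<Gamma>'"
    using assms(7,9) by (auto simp: open_conic_nhd_def)
  note window_change = assms(3,4,5,11,2) cones assms(10)
  show ?thesis
  proof (cases "p = \<infinity>")
    case True
    then show ?thesis using stft_window_change_infinity[OF window_change] assms(8) by simp
  next
    case False
    then have "1 \<le> enn2real p" using assms(1) by (cases p) auto
    from stft_window_change_finite[OF window_change this] show ?thesis
      using assms(8) False by (simp add: weighted_Lp_on_def)
  qed
qed


end
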